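(* Let $X=(X_1,\dots,X_d)\sim\mathcal N(0,\Sigma_\rho)$ with $\Sigma_\rho$ an invertible $d\times d$ covariance matrix, and write $\sigma_{ij}=(\Sigma_\rho)_{ij}$. Suppose $f:\mathbb R\to\mathbb R$ is given by $$f(x)=\sum_{u\ge 0}\frac{f^{(2u+1)}(0)}{(2u+1)!}\,x^{2u+1}.$$ For odd $k\ge 1$ define $$F_k(x)=\sum_{u\ge 0}\frac{f^{(2u+k)}(0)}{u!}\,x^u,\qquad G_{kij}(x)=F_k(\sigma_{ii}x)\,F_k(\sigma_{jj}x).$$ Let $Y_i=f(X_i)$ and let $\tau_{ij}=\mathbb E[f(X_i)f(X_j)]$ be the $(i,j)$ entry of the covariance matrix of $Y=(Y_1,\dots,Y_d)$. Assume that the series obtained by inserting the Taylor series of $f$ into these moments converge, so that the moments may be computed term by term. Then $\sigma_{ij}$ is transformed to $$\tau_{ij}=\sum_{k\ \mathrm{odd},\ k\ge 1}G_{kij}(1/2)\,\frac{\sigma_{ij}^k}{k!}$$ for all $i,j$.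
   Context: The covariance matrix of $Y$ equals $\mathbb E[f(X)f(X)^T]$, where $f$ is applied entrywise, because $f$ is odd and $X$ is a mean-zero Gaussian vector, so that $\mathbb E[f(X_i)]=0$. Here $\sigma_{ii}$ denotes the variance of $X_i$ (not its standard deviation). The series whose convergence is assumed is $\sum_{n\ge 0}\sum_{p=0}^{n}\frac{f^{(p)}(0)f^{(n-p)}(0)}{p!(n-p)!}\,\mathbb E[X_i^pX_j^{n-p}]$, which is the term-by-term expansion of $\mathbb E[f(X_i)f(X_j)]$. *)

theory Defs
  imports "HOL-Probability.Probability"
begin

text \<open>Covariance matrices are symmetric and positive semidefinite.\<close>

definition is_covariance_matrix :: "real ^ 'd ^ 'd \<Rightarrow> bool" where
  "is_covariance_matrix S \<longleftrightarrow> transpose S = S \<and> (\<forall>v. 0 \<le> v \<bullet> (S *v v))"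

text \<open>The Lebesgue density of \<open>N(\<mu>, S)\<close>; only meaningful for invertible \<open>S\<close>.\<close>

definition mvn_density :: "real ^ 'd \<Rightarrow> real ^ 'd ^ 'd \<Rightarrow> real ^ 'd \<Rightarrow> real" where
  "mvn_density \<mu> S x =
     exp (- ((x - \<mu>) \<bullet> (matrix_inv S *v (x - \<mu>))) / 2) / sqrt ((2 * pi) ^ CARD('d) * det S)"

definition covariance_matrix_of :: "'a measure \<Rightarrow> ('a \<Rightarrow> real ^ 'd) \<Rightarrow> real ^ 'd ^ 'd" where
  "covariance_matrix_of M Y =
     (\<chi> i j. \<integral>\<omega>. (Y \<omega> $ i - (\<integral>\<eta>. Y \<eta> $ i \<partial>M)) * (Y \<omega> $ j - (\<integral>\<eta>. Y \<eta> $ j \<partial>M)) \<partial>M)"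

definition F :: "(real \<Rightarrow> real) \<Rightarrow> nat \<Rightarrow> real \<Rightarrow> real" where
  "F f k x = (\<Sum>u. (deriv ^^ (2 * u + k)) f 0 / fact u * x ^ u)"

definition G :: "(real \<Rightarrow> real) \<Rightarrow> real ^ 'd ^ 'd \<Rightarrow> nat \<Rightarrow> 'd \<Rightarrow> 'd \<Rightarrow> real \<Rightarrow> real" where
  "G f S k i j x = F f k (S $ i $ i * x) * F f k (S $ j $ j * x)"

end

theory Submission
  imports Defs "HOL-Complex_Analysis.Cauchy_Integral_Formula"
begin

text \<open>
  Write $\sigma_{ij}$ for the entries of $S$ and put $Z_i = X_i / \sqrt{\sigma_{ii}}$, so that
  $f(X_i) = \varphi_i(Z_i)$ where $\varphi_i$ has the Taylor coefficients
  $b_p = f^{(p)}(0)\,\sigma_{ii}^{p/2} / p!$. The formula to be proved is Mehler's formula: for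
  standard normal variables $Z, W$ with correlation $\rho$,
  \[ E[\varphi(Z)\,\psi(W)] = \sum_k M_k(\varphi)\,M_k(\psi)\,\rho^k / k!, \]
  where $M_k(\varphi)$ is the expectation of $\varphi(Z)$ times the $k$-th Hermite polynomial of $Z$,
  formally the expectation of $\varphi^{(k)}(Z)$. On monomials $M_k$ is explicit, and summing over the Taylor series gives
  $M_k(\varphi_i) = \sigma_{ii}^{k/2}\, F_k(\sigma_{ii}/2)$; as
  $\rho = \sigma_{ij} / \sqrt{\sigma_{ii}\sigma_{jj}}$, the $k$-th term becomes
  $G_{kij}(1/2)\,\sigma_{ij}^k / k!$.

  On monomials, Mehler's formula follows by comparing coefficients in the joint moment generating
  function, which for a vector with density \<open>mvn_density\<close> comes from completing the square. The work
  is in the passage to the series, because the assumed convergence is only conditional and only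
  term by term in the total degree.

  The diagonal instances of the assumption control the growth of $f$. For $i = j$ the assumption says that
  $\sum_n c_n E[Z^n]$ converges, with $c_n$ the Taylor coefficients of $\varphi_i^2$. Hence
  $c_n E[Z^n]$ is bounded, which makes $\varphi_i^2$ an entire function that grows at most like
  $\exp(\eta |z|^2/2)$ for each $\eta > 1$. Then $\varphi_i$ grows at most like
  $\exp(\eta |z|^2/4)$, and by Cauchy's inequality so does $\sum_p |b_p| |z|^p$
  (\<open>subgaussian_if_square_moments_bounded\<close>). For $|\rho| < 1$ the variable
  $\exp(\eta (Z^2 + W^2)/4)$ is integrable when $\eta$ is close to $1$, so everything converges
  absolutely and Mehler's formula holds (\<open>mehler_expansion\<close>). As $S$ is invertible, this covers
  $i \neq j$.

  For $i = j$ the correlation is $1$ and absolute convergence may fail. That $\varphi_i(Z)$ is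
  square integrable follows from Abel summation and Fatou's lemma for the contracted functions
  $\varphi_i(tZ)$, $t \to 1$ (\<open>integrable_square_if_moment_series_converges\<close>). The identity
  $E[\varphi(Z)^2] = \sum_k M_k(\varphi)^2 / k!$ is then the limit of Mehler's formula as $\rho \to 1$:
  one inequality is $2\varphi(Z)\varphi(W) \le \varphi(Z)^2 + \varphi(W)^2$, the other is Fatou's lemma
  for the Ornstein-Uhlenbeck averages of $\varphi$, which converge to $\varphi$ pointwise and whose
  second moments are again given by Mehler's formula (\<open>hermite_parseval\<close>).
\<close>

section \<open>Power series and termwise integration\<close>

lemma iterated_deriv_powser_at_0:
  fixes c :: "nat \<Rightarrow> 'a::{real_normed_field,banach}"
  assumes sums: "\<And>x. (\<lambda>n. c n * x ^ n) sums f x"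
  shows "(deriv ^^ n) f 0 = fact n * c n"
proof -
  have smbl: "summable (\<lambda>n. (diffs ^^ k) c n * x ^ n)" for k x
    by (induction k arbitrary: x) (use sums in \<open>auto simp: sums_iff intro: termdiff_converges_all\<close>)
  have "(deriv ^^ k) f = (\<lambda>x. \<Sum>n. (diffs ^^ k) c n * x ^ n)" for k
  proof (induction k)
    case 0
    show ?case using sums by (auto simp: sums_iff)
  next
    case (Suc k)
    show ?case
      using termdiffs_strong_converges_everywhere[OF smbl, of k]
      by (auto simp: Suc intro!: DERIV_imp_deriv)
  qed
  then have "(deriv ^^ n) f 0 = (diffs ^^ n) c 0" by simp
  moreover have "(diffs ^^ k) c m = fact (m + k) / fact m * c (m + k)" for k m
  proof (induction k arbitrary: m)
    case (Suc k)
    have "(diffs ^^ Suc k) c m = of_nat (Suc m) * ((diffs ^^ k) c (Suc m))"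
      by (simp add: diffs_def)
    also have "\<dots> = of_nat (Suc m) * (fact (m + Suc k) / fact (Suc m) * c (m + Suc k))"
      by (simp only: Suc add_Suc_shift)
    finally show ?case by (simp del: of_nat_Suc)
  qed simp
  ultimately show ?thesis by simp
qed

lemma powser_coeffs_unique:
  fixes c d :: "nat \<Rightarrow> 'a::{real_normed_field,banach}"
  assumes "\<And>x. (\<lambda>n. c n * x ^ n) sums f x" and "\<And>x. (\<lambda>n. d n * x ^ n) sums f x"
  shows "c = d"
proof
  fix n
  have "fact n * c n = fact n * d n"
    using iterated_deriv_powser_at_0[of c f n] iterated_deriv_powser_at_0[of d f n] assms by metis
  then show "c n = d n" by simp
qed

lemma powser_coeff_bound:
  fixes c :: "nat \<Rightarrow> complex"
  assumes sums: "\<And>z. (\<lambda>n. c n * z ^ n) sums f z" and "0 < r"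
    and bound: "\<And>z. norm z = r \<Longrightarrow> norm (f z) \<le> B"
  shows "norm (c n) \<le> B / r ^ n"
proof -
  have "f = (\<lambda>z. \<Sum>n. c n * z ^ n)"
    using sums by (auto simp: sums_iff)
  then have "\<exists>D. (f has_field_derivative D) (at z)" for z
    using termdiffs_strong_converges_everywhere[of c z] sums by (auto simp: sums_iff)
  then have hol: "f holomorphic_on A" for A
    unfolding holomorphic_on_def field_differentiable_def
    using has_field_derivative_at_within by blast
  have "norm ((deriv ^^ n) f 0) \<le> fact n * B / r ^ n"
    by (rule Cauchy_inequality)
      (use \<open>0 < r\<close> bound in \<open>auto intro: hol holomorphic_on_imp_continuous_on\<close>)
  then have "fact n * norm (c n) \<le> fact n * (B / r ^ n)"
    unfolding iterated_deriv_powser_at_0[OF sums] by (simp add: norm_mult)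
  then show ?thesis
    by (rule mult_left_le_imp_le) simp
qed

lemma powser_conv_everywhere_complex:
  fixes b :: "nat \<Rightarrow> real"
  assumes "\<And>x. summable (\<lambda>n. b n * x ^ n)"
  shows "summable (\<lambda>n. norm (complex_of_real (b n) * z ^ n))"
proof -
  have "summable (\<lambda>n. norm (b n * norm z ^ n))"
    by (rule powser_insidea[OF assms[of "norm z + 1"]]) simp
  then show ?thesis by (simp add: norm_mult norm_power abs_mult)
qed

text \<open>Dominating the partial sums suits the series met below: $\sum_{n<N} x^n / n!$ stays below $e^{|x|}$, and a power
series below its majorant, and both bounds have known Gaussian expectations.\<close>

lemma integral_sums_dominated:
  fixes h :: "nat \<Rightarrow> 'a \<Rightarrow> 'b::{banach, second_countable_topology}"
  assumes meas: "\<And>n. h n \<in> borel_measurable M"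
    and sums: "\<And>x. x \<in> space M \<Longrightarrow> (\<lambda>n. h n x) sums g x"
    and w: "integrable M w"
    and bound: "\<And>N x. x \<in> space M \<Longrightarrow> norm (\<Sum>n<N. h n x) \<le> w x"
  shows "integrable M g" and "\<And>n. integrable M (h n)"
    and "(\<lambda>n. \<integral>x. h n x \<partial>M) sums (\<integral>x. g x \<partial>M)"
proof -
  have lim: "AE x in M. (\<lambda>N. \<Sum>n<N. h n x) \<longlonglongrightarrow> g x"
    using sums by (auto simp: sums_def)
  have bd: "\<And>N. AE x in M. norm (\<Sum>n<N. h n x) \<le> w x"
    using bound by auto
  have mN: "\<And>N. (\<lambda>x. \<Sum>n<N. h n x) \<in> borel_measurable M"
    using meas by auto
  have mg: "g \<in> borel_measurable M"
    by (rule borel_measurable_LIMSEQ_metric[OF mN]) (use sums in \<open>auto simp: sums_def\<close>)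
  show "integrable M g"
    by (rule integrable_dominated_convergence[OF mg mN w lim bd])
  have i: "integrable M (\<lambda>x. \<Sum>n<N. h n x)" for N
    by (rule integrable_dominated_convergence2[OF mg mN w lim bd])
  show int: "integrable M (h n)" for n
    using Bochner_Integration.integrable_diff[OF i[of "Suc n"] i[of n]] by simp
  show "(\<lambda>n. \<integral>x. h n x \<partial>M) sums (\<integral>x. g x \<partial>M)"
    using integral_dominated_convergence[OF mg mN w lim bd] int by (simp add: sums_def)
qed


lemma abs_exp_partial_sum_le: "\<bar>\<Sum>n<N. x ^ n / fact n\<bar> \<le> exp \<bar>x :: real\<bar>"
proof -
  have "\<bar>\<Sum>n<N. x ^ n / fact n\<bar> \<le> (\<Sum>n<N. \<bar>x\<bar> ^ n / fact n)"
    using sum_abs[of "\<lambda>n. x ^ n / fact n" "{..<N}"] by (simp add: power_abs)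
  also have "\<dots> \<le> (\<Sum>n. \<bar>x\<bar> ^ n / fact n)"
    using summable_exp[of "\<bar>x\<bar>"] by (intro sum_le_suminf) (auto simp: field_simps)
  also have "\<dots> = exp \<bar>x\<bar>"
    using sums_unique[OF exp_converges[of "\<bar>x\<bar>"]] by (simp add: divide_inverse mult.commute)
  finally show ?thesis .
qed

lemma power_le_fact_exp: "0 \<le> x \<Longrightarrow> x ^ n \<le> fact n * exp (x :: real)"
proof -
  assume "0 \<le> x"
  then have "x ^ n / fact n \<le> (\<Sum>n. x ^ n / fact n)"
    using summable_exp[of x] sum_le_suminf[of "\<lambda>n. x ^ n / fact n" "{n}"]
    by (auto simp: field_simps)
  also have "\<dots> = exp x"
    using sums_unique[OF exp_converges[of x]] by (simp add: divide_inverse mult.commute)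
  finally show ?thesis by (simp add: field_simps)
qed

lemma exp_sums_divide_fact: "(\<lambda>n. x ^ n / fact n) sums exp (x::real)"
  using exp_converges[of x] by (simp add: divide_inverse mult.commute)

section \<open>Normal moments and their generating functions\<close>

definition normal_moment :: "nat \<Rightarrow> real" where
  "normal_moment n = (\<integral>x. x ^ n \<partial>std_normal_distribution)"

text \<open>This is the expectation of $Z^p$ times the $k$-th probabilists' Hermite polynomial of a standard normal
$Z$. It is also the expectation of the $k$-th derivative of $z^p$ at $Z$, whence this formula, in which the
binomial coefficient makes the value $0$ for $p < k$.\<close>

definition hermite_moment :: "nat \<Rightarrow> nat \<Rightarrow> real" where
  "hermite_moment p k = real (p choose k) * fact k * normal_moment (p - k)"

lemma normal_moment_even: "normal_moment (2 * u) = fact (2 * u) / (2 ^ u * fact u)"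
  and normal_moment_odd: "odd n \<Longrightarrow> normal_moment n = 0"
  unfolding normal_moment_def
  using std_normal_distribution_even_moments(1) integral_std_normal_distribution_moment_odd by auto

lemma normal_moment_nonneg: "0 \<le> normal_moment n"
  by (cases "even n") (auto elim!: evenE simp: normal_moment_even normal_moment_odd)

lemma hermite_moment_nonneg: "0 \<le> hermite_moment p k"
  by (simp add: hermite_moment_def normal_moment_nonneg)

lemma hermite_moment_eq_0: "p < k \<Longrightarrow> hermite_moment p k = 0"
  by (simp add: hermite_moment_def)

lemma hermite_moment_0: "hermite_moment p 0 = normal_moment p"
  by (simp add: hermite_moment_def)

lemma hermite_moment_add: "hermite_moment (n + k) k = fact (n + k) / fact n * normal_moment n"
  by (simp add: hermite_moment_def binomial_fact)

lemma normal_moment_egf: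
  fixes x :: "'a::{real_normed_field,banach}"
  shows "(\<lambda>n. of_real (normal_moment n / fact n) * x ^ n) sums exp (x\<^sup>2 / 2)"
proof -
  have "(\<lambda>u. (x\<^sup>2 / 2) ^ u /\<^sub>R fact u) sums exp (x\<^sup>2 / 2)"
    by (rule exp_converges)
  moreover have "(x\<^sup>2 / 2) ^ u /\<^sub>R fact u
      = (\<lambda>n. of_real (normal_moment n / fact n) * x ^ n) (2 * u)" for u
    by (simp only: normal_moment_even power_mult power_divide scaleR_conv_of_real) (simp add: field_simps)
  ultimately have "(\<lambda>u. (\<lambda>n. of_real (normal_moment n / fact n) * x ^ n) (2 * u)) sums exp (x\<^sup>2 / 2)"
    by simp
  moreover have "n \<notin> range (\<lambda>u. 2 * u) \<Longrightarrow> normal_moment n = 0" for n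
    by (rule normal_moment_odd) auto
  ultimately show ?thesis
    by (subst (asm) sums_mono_reindex) (auto simp: strict_mono_def)
qed

lemma normal_moment_egf_summable:
  fixes x :: real
  shows "summable (\<lambda>n. norm (normal_moment n / fact n * x ^ n))"
  using normal_moment_egf[of "\<bar>x\<bar>"] normal_moment_nonneg
  by (simp add: abs_mult power_abs sums_iff)

lemma hermite_moment_egf:
  fixes b :: real
  shows "(\<lambda>q. hermite_moment q k / fact q * b ^ q) sums (b ^ k * exp (b\<^sup>2 / 2))"
proof -
  have "(\<lambda>n. b ^ k * (normal_moment n / fact n * b ^ n)) sums (b ^ k * exp (b\<^sup>2 / 2))"
    using normal_moment_egf[of b] by (intro sums_mult) simp
  moreover have "b ^ k * (normal_moment n / fact n * b ^ n)
    = hermite_moment (n + k) k / fact (n + k) * b ^ (n + k)" for n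
    unfolding hermite_moment_add power_add by simp
  ultimately show ?thesis
    by (subst sums_zero_iff_shift[of k, symmetric]) (auto simp: hermite_moment_eq_0)
qed

text \<open>The moment generating function of a standard normal pair with correlation $\rho$ is
$e^{b^2/2} e^{a^2/2 + \rho b a}$. This is its expansion in $a$, with $c = \rho b$; the expansion in $b$ of the
resulting coefficients is \<open>hermite_moment_egf\<close>.\<close>

lemma exp_Cauchy_hermite:
  fixes a c :: real
  shows "(\<lambda>p. (\<Sum>k\<le>p. hermite_moment p k * c ^ k / fact k) / fact p * a ^ p)
           sums exp (a\<^sup>2 / 2 + c * a)"
proof -
  have "(\<lambda>p. \<Sum>k\<le>p. ((c * a) ^ k /\<^sub>R fact k) * (normal_moment (p - k) / fact (p - k) * a ^ (p - k)))
      sums ((\<Sum>k. (c * a) ^ k /\<^sub>R fact k) * (\<Sum>n. normal_moment n / fact n * a ^ n))"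
    by (rule Cauchy_product_sums[OF summable_norm_exp normal_moment_egf_summable])
  also have "(\<Sum>k. (c * a) ^ k /\<^sub>R fact k) * (\<Sum>n. normal_moment n / fact n * a ^ n)
      = exp (a\<^sup>2 / 2 + c * a)"
    proof -
    have "(\<Sum>k. (c * a) ^ k /\<^sub>R fact k) = exp (c * a)"
      by (rule sums_unique[OF exp_converges, symmetric])
    moreover have "(\<Sum>n. normal_moment n / fact n * a ^ n) = exp (a\<^sup>2 / 2)"
      using normal_moment_egf[of a] by (simp add: sums_iff)
    ultimately show ?thesis by (simp add: mult_exp_exp add.commute)
  qed
  also have "(\<lambda>p. \<Sum>k\<le>p. ((c * a) ^ k /\<^sub>R fact k) * (normal_moment (p - k) / fact (p - k) * a ^ (p - k)))
      = (\<lambda>p. (\<Sum>k\<le>p. hermite_moment p k * c ^ k / fact k) / fact p * a ^ p)"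
  proof
    fix p
    have "((c * a) ^ k /\<^sub>R fact k) * (normal_moment (p - k) / fact (p - k) * a ^ (p - k))
        = hermite_moment p k * c ^ k / fact k / fact p * a ^ p" if kp: "k \<le> p" for k
    proof -
      obtain n where n: "p = n + k" using le_Suc_ex[OF kp] by (auto simp: add.commute)
      show ?thesis
        unfolding n hermite_moment_add power_add power_mult_distrib by (simp add: field_simps)
    qed
    then show "(\<Sum>k\<le>p. ((c * a) ^ k /\<^sub>R fact k) * (normal_moment (p - k) / fact (p - k) * a ^ (p - k)))
        = (\<Sum>k\<le>p. hermite_moment p k * c ^ k / fact k) / fact p * a ^ p"
      by (simp add: sum_divide_distrib sum_distrib_right)
  qed
  finally show ?thesis .
qed

section \<open>Pairs of random variables with a Gaussian joint moment generating function\<close>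

text \<open>Two standard normal variables with correlation $\rho$, jointly Gaussian. Prescribing the generating
function covers $|\rho| = 1$, where no joint density exists; the choice $W = Z$, $\rho = 1$
describes a single standard normal variable. The nonnegative integral makes the existence of the
exponential moments part of the condition.\<close>

locale gauss_pair = prob_space M for M :: "'a measure" +
  fixes Z W :: "'a \<Rightarrow> real" and \<rho> :: real
  assumes Z_measurable [measurable]: "Z \<in> borel_measurable M"
    and W_measurable [measurable]: "W \<in> borel_measurable M"
    and mgf: "\<And>a b. (\<integral>\<^sup>+\<omega>. ennreal (exp (a * Z \<omega> + b * W \<omega>)) \<partial>M)
                 = ennreal (exp ((a\<^sup>2 + b\<^sup>2) / 2 + \<rho> * a * b))"
begin

lemma has_mgf:
  "integrable M (\<lambda>\<omega>. exp (a * Z \<omega> + b * W \<omega>))"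
  "(\<integral>\<omega>. exp (a * Z \<omega> + b * W \<omega>) \<partial>M) = exp ((a\<^sup>2 + b\<^sup>2) / 2 + \<rho> * a * b)"
  using mgf[of a b] by (subst (asm) nn_integral_eq_integrable; simp)+

lemma integrable_exp_abs: "integrable M (\<lambda>\<omega>. exp (a * \<bar>Z \<omega>\<bar> + b * \<bar>W \<omega>\<bar>))"
proof (rule Bochner_Integration.integrable_bound)
  show "integrable M (\<lambda>\<omega>. exp (a * Z \<omega> + b * W \<omega>) + exp (a * Z \<omega> + (- b) * W \<omega>)
      + exp ((- a) * Z \<omega> + b * W \<omega>) + exp ((- a) * Z \<omega> + (- b) * W \<omega>))"
    by (intro Bochner_Integration.integrable_add has_mgf(1))
  have "exp (a * \<bar>z\<bar> + b * \<bar>w\<bar>) \<le> exp (a * z + b * w) + exp (a * z + (- b) * w)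
      + exp ((- a) * z + b * w) + exp ((- a) * z + (- b) * w)" for z w :: real
  proof -
    have "exp (a * \<bar>z\<bar> + b * \<bar>w\<bar>) = exp (a * z + b * w) \<or> exp (a * \<bar>z\<bar> + b * \<bar>w\<bar>) = exp (a * z + (- b) * w)
      \<or> exp (a * \<bar>z\<bar> + b * \<bar>w\<bar>) = exp ((- a) * z + b * w) \<or> exp (a * \<bar>z\<bar> + b * \<bar>w\<bar>) = exp ((- a) * z + (- b) * w)"
      by (auto simp: abs_if)
    then show ?thesis
      using exp_gt_zero[of "a * z + b * w"] exp_gt_zero[of "a * z + (- b) * w"]
        exp_gt_zero[of "(- a) * z + b * w"] exp_gt_zero[of "(- a) * z + (- b) * w"]
      by linarith
  qed
  then show "AE \<omega> in M. norm (exp (a * \<bar>Z \<omega>\<bar> + b * \<bar>W \<omega>\<bar>)) \<le> norm (exp (a * Z \<omega> + b * W \<omega>) + exp (a * Z \<omega> + (- b) * W \<omega>)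
      + exp ((- a) * Z \<omega> + b * W \<omega>) + exp ((- a) * Z \<omega> + (- b) * W \<omega>))"
    unfolding real_norm_def abs_exp_cancel by (intro AE_I2 order_trans[OF _ abs_ge_self])
qed measurable

text \<open>Both sides are coefficients, up to $p!$, of the generating function as a power series in $a$ alone.\<close>

lemma mixed_moment_exp:
  "(\<integral>\<omega>. Z \<omega> ^ p * exp (b * W \<omega>) \<partial>M)
     = exp (b\<^sup>2 / 2) * (\<Sum>k\<le>p. hermite_moment p k * (\<rho> * b) ^ k / fact k)"
proof -
  define E where "E n = (\<integral>\<omega>. Z \<omega> ^ n * exp (b * W \<omega>) \<partial>M)" for n
  have "(\<lambda>n. E n / fact n * a ^ n) sums exp ((a\<^sup>2 + b\<^sup>2) / 2 + \<rho> * a * b)" for a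
  proof -
    have "(\<lambda>n. \<integral>\<omega>. (a * Z \<omega>) ^ n / fact n * exp (b * W \<omega>) \<partial>M)
        sums (\<integral>\<omega>. exp (a * Z \<omega>) * exp (b * W \<omega>) \<partial>M)"
    proof (rule integral_sums_dominated)
      show "integrable M (\<lambda>\<omega>. exp (\<bar>a\<bar> * \<bar>Z \<omega>\<bar> + \<bar>b\<bar> * \<bar>W \<omega>\<bar>))"
        by (rule integrable_exp_abs)
      show "(\<lambda>n. (a * Z \<omega>) ^ n / fact n * exp (b * W \<omega>)) sums (exp (a * Z \<omega>) * exp (b * W \<omega>))" for \<omega>
        by (intro sums_mult2 exp_sums_divide_fact)
      show "norm (\<Sum>n<N. (a * Z \<omega>) ^ n / fact n * exp (b * W \<omega>))
          \<le> exp (\<bar>a\<bar> * \<bar>Z \<omega>\<bar> + \<bar>b\<bar> * \<bar>W \<omega>\<bar>)" for N \<omega>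
      proof -
        have "exp (b * W \<omega>) \<le> exp (\<bar>b\<bar> * \<bar>W \<omega>\<bar>)"
          by (simp flip: abs_mult)
        then have "\<bar>\<Sum>n<N. (a * Z \<omega>) ^ n / fact n\<bar> * exp (b * W \<omega>) \<le> exp \<bar>a * Z \<omega>\<bar> * exp (\<bar>b\<bar> * \<bar>W \<omega>\<bar>)"
          by (intro mult_mono abs_exp_partial_sum_le) auto
        then show ?thesis
          unfolding sum_distrib_right[symmetric] real_norm_def abs_mult by (simp add: exp_add)
      qed
    qed measurable
    moreover have "(\<integral>\<omega>. (a * Z \<omega>) ^ n / fact n * exp (b * W \<omega>) \<partial>M) = E n / fact n * a ^ n" for n
    proof -
      have "(a * Z \<omega>) ^ n / fact n * exp (b * W \<omega>) = (a ^ n / fact n) * (Z \<omega> ^ n * exp (b * W \<omega>))" for \<omega>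
        by (simp add: power_mult_distrib)
      then have "(\<integral>\<omega>. (a * Z \<omega>) ^ n / fact n * exp (b * W \<omega>) \<partial>M) = (a ^ n / fact n) * E n"
        unfolding E_def by (simp only: integral_mult_right_zero)
      then show ?thesis by simp
    qed
    ultimately show ?thesis
      using has_mgf(2)[of a b] by (simp add: exp_add)
  qed
  moreover have "(\<lambda>n. exp (b\<^sup>2 / 2) * ((\<Sum>k\<le>n. hermite_moment n k * (\<rho> * b) ^ k / fact k) / fact n) * a ^ n)
      sums exp ((a\<^sup>2 + b\<^sup>2) / 2 + \<rho> * a * b)" for a
    using sums_mult[OF exp_Cauchy_hermite[of "\<rho> * b" a], of "exp (b\<^sup>2 / 2)"]
    by (simp add: mult_exp_exp add_divide_distrib ac_simps)
  ultimately have "(\<lambda>n. E n / fact n)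
    = (\<lambda>n. exp (b\<^sup>2 / 2) * ((\<Sum>k\<le>n. hermite_moment n k * (\<rho> * b) ^ k / fact k) / fact n))"
    by (rule powser_coeffs_unique)
  from fun_cong[OF this, of p] show ?thesis unfolding E_def by simp
qed

text \<open>Expanding \<open>mixed_moment_exp\<close> in powers of $b$ as well gives Mehler's formula for monomials.\<close>

lemma
  shows integrable_moment: "integrable M (\<lambda>\<omega>. Z \<omega> ^ p * W \<omega> ^ q)"
    and mixed_moment_eq: "(\<integral>\<omega>. Z \<omega> ^ p * W \<omega> ^ q \<partial>M)
       = (\<Sum>k\<le>p. hermite_moment p k * hermite_moment q k * \<rho> ^ k / fact k)"
proof -
  define E where "E n = (\<integral>\<omega>. Z \<omega> ^ p * W \<omega> ^ n \<partial>M)" for n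
  have *: "(\<lambda>n. \<integral>\<omega>. Z \<omega> ^ p * ((b * W \<omega>) ^ n / fact n) \<partial>M)
        sums (\<integral>\<omega>. Z \<omega> ^ p * exp (b * W \<omega>) \<partial>M)" (is ?A)
     and int: "integrable M (\<lambda>\<omega>. Z \<omega> ^ p * ((b * W \<omega>) ^ n / fact n))" (is ?B) for b n
  proof -
    have s: "(\<lambda>n. Z \<omega> ^ p * ((b * W \<omega>) ^ n / fact n)) sums (Z \<omega> ^ p * exp (b * W \<omega>))" for \<omega>
      by (intro sums_mult exp_sums_divide_fact)
    have i: "integrable M (\<lambda>\<omega>. fact p * exp (1 * \<bar>Z \<omega>\<bar> + \<bar>b\<bar> * \<bar>W \<omega>\<bar>))"
      by (intro Bochner_Integration.integrable_mult_right integrable_exp_abs)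
    have bd: "norm (\<Sum>n<N. Z \<omega> ^ p * ((b * W \<omega>) ^ n / fact n))
          \<le> fact p * exp (1 * \<bar>Z \<omega>\<bar> + \<bar>b\<bar> * \<bar>W \<omega>\<bar>)" for N \<omega>
    proof -
      have "norm (\<Sum>n<N. Z \<omega> ^ p * ((b * W \<omega>) ^ n / fact n))
          = \<bar>Z \<omega>\<bar> ^ p * \<bar>\<Sum>n<N. (b * W \<omega>) ^ n / fact n\<bar>"
        unfolding sum_distrib_left[symmetric] by (simp add: abs_mult power_abs)
      also have "\<dots> \<le> (fact p * exp \<bar>Z \<omega>\<bar>) * exp \<bar>b * W \<omega>\<bar>"
        by (intro mult_mono power_le_fact_exp abs_exp_partial_sum_le) auto
      finally show ?thesis by (simp add: exp_add abs_mult)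
    qed
    show ?A ?B
      by (rule integral_sums_dominated[OF _ s i bd]; measurable)+
  qed
  show "integrable M (\<lambda>\<omega>. Z \<omega> ^ p * W \<omega> ^ q)"
    using Bochner_Integration.integrable_mult_right[OF int[of 1 q], of "fact q"] by simp
  have "(\<lambda>n. E n / fact n * b ^ n) sums (exp (b\<^sup>2 / 2) * (\<Sum>k\<le>p. hermite_moment p k * (\<rho> * b) ^ k / fact k))" for b
  proof -
    have "(\<integral>\<omega>. Z \<omega> ^ p * ((b * W \<omega>) ^ n / fact n) \<partial>M) = E n / fact n * b ^ n" for n
    proof -
      have "Z \<omega> ^ p * ((b * W \<omega>) ^ n / fact n) = (b ^ n / fact n) * (Z \<omega> ^ p * W \<omega> ^ n)" for \<omega>
        by (simp add: power_mult_distrib)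
      then have "(\<integral>\<omega>. Z \<omega> ^ p * ((b * W \<omega>) ^ n / fact n) \<partial>M) = (b ^ n / fact n) * E n"
        unfolding E_def by (simp only: integral_mult_right_zero)
      then show ?thesis by simp
    qed
    then show ?thesis using *[of b] by (simp add: mixed_moment_exp)
  qed
  moreover have "(\<lambda>n. (\<Sum>k\<le>p. hermite_moment p k * hermite_moment n k * \<rho> ^ k / fact k) / fact n * b ^ n)
     sums (exp (b\<^sup>2 / 2) * (\<Sum>k\<le>p. hermite_moment p k * (\<rho> * b) ^ k / fact k))" for b
  proof -
    have "(\<lambda>n. \<Sum>k\<le>p. hermite_moment p k * \<rho> ^ k / fact k * (hermite_moment n k / fact n * b ^ n))
      sums (\<Sum>k\<le>p. hermite_moment p k * \<rho> ^ k / fact k * (b ^ k * exp (b\<^sup>2 / 2)))"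
      by (intro sums_sum sums_mult hermite_moment_egf)
    then show ?thesis
      by (simp add: sum_distrib_left sum_distrib_right sum_divide_distrib power_mult_distrib ac_simps)
  qed
  ultimately have "(\<lambda>n. E n / fact n)
    = (\<lambda>n. (\<Sum>k\<le>p. hermite_moment p k * hermite_moment n k * \<rho> ^ k / fact k) / fact n)"
    by (rule powser_coeffs_unique)
  from fun_cong[OF this, of q] show "(\<integral>\<omega>. Z \<omega> ^ p * W \<omega> ^ q \<partial>M)
       = (\<Sum>k\<le>p. hermite_moment p k * hermite_moment q k * \<rho> ^ k / fact k)"
    unfolding E_def by simp
qed

lemma moment_Z: "integrable M (\<lambda>\<omega>. Z \<omega> ^ p)" "(\<integral>\<omega>. Z \<omega> ^ p \<partial>M) = normal_moment p"
proof -
  show "integrable M (\<lambda>\<omega>. Z \<omega> ^ p)" using integrable_moment[of p 0] by simp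
  have "(\<Sum>k\<le>p. hermite_moment p k * hermite_moment 0 k * \<rho> ^ k / fact k)
      = (\<Sum>k\<in>{0}. hermite_moment p k * hermite_moment 0 k * \<rho> ^ k / fact k)"
    by (rule sum.mono_neutral_right) (auto simp: hermite_moment_eq_0)
  then show "(\<integral>\<omega>. Z \<omega> ^ p \<partial>M) = normal_moment p"
    using mixed_moment_eq[of p 0] normal_moment_even[of 0] by (simp add: hermite_moment_0)
qed

text \<open>The moments agree with the normal moments, and the exponential moments let the characteristic function
be computed from them by integrating the exponential series.\<close>

lemma distr_Z: "distr M borel Z = std_normal_distribution"
proof (rule Levy_uniqueness)
  show "real_distribution (distr M borel Z)"
    by (rule real_distribution_distr) measurable
  show "real_distribution std_normal_distribution"
    by (rule real_dist_normal_dist)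
  show "char (distr M borel Z) = char std_normal_distribution"
  proof
    fix t :: real
    have exp_sums: "(\<lambda>n. (\<i> * (t * Z \<omega>)) ^ n / fact n) sums iexp (t * Z \<omega>)" for \<omega>
      using exp_converges[of "\<i> * (t * Z \<omega>)"] by (simp add: scaleR_conv_of_real divide_inverse mult.commute)
    have bd: "norm (\<Sum>n<N. (\<i> * (t * Z \<omega>)) ^ n / fact n) \<le> exp (\<bar>t\<bar> * \<bar>Z \<omega>\<bar> + 0 * \<bar>W \<omega>\<bar>)" for N \<omega>
    proof -
      have "norm (\<Sum>n<N. (\<i> * (t * Z \<omega>)) ^ n / fact n) \<le> (\<Sum>n<N. \<bar>t * Z \<omega>\<bar> ^ n / fact n)"
        by (rule order_trans[OF norm_sum]) (simp add: norm_divide norm_power norm_mult abs_mult)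
      also have "\<dots> \<le> exp \<bar>\<bar>t * Z \<omega>\<bar>\<bar>"
        using abs_exp_partial_sum_le[of "\<bar>t * Z \<omega>\<bar>" N] by simp
      finally show ?thesis by (simp add: abs_mult)
    qed
    have "(\<lambda>n. \<integral>\<omega>. (\<i> * (t * Z \<omega>)) ^ n / fact n \<partial>M) sums (\<integral>\<omega>. iexp (t * Z \<omega>) \<partial>M)"
      by (rule integral_sums_dominated[OF _ exp_sums integrable_exp_abs bd]) measurable
    moreover have "(\<integral>\<omega>. (\<i> * (t * Z \<omega>)) ^ n / fact n \<partial>M)
        = of_real (normal_moment n / fact n) * (\<i> * of_real t) ^ n" for n
    proof -
      have "(\<i> * (t * Z \<omega>)) ^ n / fact n = (\<i> * of_real t) ^ n / fact n * of_real (Z \<omega> ^ n)" for \<omega>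
        by (simp add: power_mult_distrib)
      then have "(\<integral>\<omega>. (\<i> * (t * Z \<omega>)) ^ n / fact n \<partial>M)
          = (\<i> * of_real t) ^ n / fact n * of_real (\<integral>\<omega>. Z \<omega> ^ n \<partial>M)"
        by (simp only: integral_mult_right_zero integral_complex_of_real)
      then show ?thesis by (simp add: moment_Z)
    qed
    ultimately have "(\<integral>\<omega>. iexp (t * Z \<omega>) \<partial>M) = exp ((\<i> * of_real t)\<^sup>2 / 2)"
      using normal_moment_egf[of "\<i> * complex_of_real t"] sums_unique2 by simp
    moreover have "exp ((\<i> * of_real t)\<^sup>2 / 2) = complex_of_real (exp (- t\<^sup>2 / 2))"
      using exp_of_real[of "- t\<^sup>2 / 2", where 'a = complex] by (simp add: power_mult_distrib)
    ultimately show "char (distr M borel Z) t = char std_normal_distribution t"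
      by (simp add: char_std_normal_distribution char_def integral_distr)
  qed
qed

lemma gauss_pair_swap: "gauss_pair M W Z \<rho>"
proof unfold_locales
  show "(\<integral>\<^sup>+\<omega>. ennreal (exp (a * W \<omega> + b * Z \<omega>)) \<partial>M)
      = ennreal (exp ((a\<^sup>2 + b\<^sup>2) / 2 + \<rho> * a * b))" for a b
    using mgf[of b a] by (simp add: ac_simps)
qed measurable

lemma gauss_pair_uminus: "gauss_pair M Z (\<lambda>\<omega>. - W \<omega>) (- \<rho>)"
proof unfold_locales
  show "(\<integral>\<^sup>+\<omega>. ennreal (exp (a * Z \<omega> + b * - W \<omega>)) \<partial>M)
      = ennreal (exp ((a\<^sup>2 + b\<^sup>2) / 2 + - \<rho> * a * b))" for a b
    using mgf[of a "- b"] by simp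
qed measurable

end

section \<open>The Gauss measure and correlated pairs on its powers\<close>

abbreviation gauss :: "real measure" where "gauss \<equiv> std_normal_distribution"

interpretation gauss: prob_space gauss
  by (rule prob_space_normal_density) simp

lemma nn_integral_gauss_exp_linear:
  "(\<integral>\<^sup>+x. ennreal (exp (a * x)) \<partial>gauss) = ennreal (exp (a\<^sup>2 / 2))"
proof -
  have "(\<integral>\<^sup>+x. ennreal (exp (a * x)) \<partial>gauss)
      = (\<integral>\<^sup>+x. ennreal (std_normal_density x) * ennreal (exp (a * x)) \<partial>lborel)"
    by (simp add: nn_integral_density)
  also have "\<dots> = (\<integral>\<^sup>+x. ennreal (exp (a\<^sup>2 / 2)) * ennreal (normal_density a 1 x) \<partial>lborel)"
  proof (rule nn_integral_cong)
    fix x :: real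
    have "exp (- x\<^sup>2 / 2) * exp (a * x) = exp (a\<^sup>2 / 2) * exp (- (x - a)\<^sup>2 / 2)"
      unfolding mult_exp_exp by (rule arg_cong[of _ _ exp]) (simp add: power2_eq_square field_simps)
    then show "ennreal (std_normal_density x) * ennreal (exp (a * x))
        = ennreal (exp (a\<^sup>2 / 2)) * ennreal (normal_density a 1 x)"
      by (simp add: normal_density_def flip: ennreal_mult)
  qed
  also have "\<dots> = ennreal (exp (a\<^sup>2 / 2)) * ennreal (\<integral>x. normal_density a 1 x \<partial>lborel)"
    by (subst nn_integral_cmult) (auto simp: nn_integral_eq_integral)
  finally show ?thesis by simp
qed

lemma nn_integral_gauss_exp_quadratic:
  assumes "c < 1"
  shows "(\<integral>\<^sup>+x. ennreal (exp (c * x\<^sup>2 / 2)) \<partial>gauss) = ennreal (1 / sqrt (1 - c))"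
proof -
  define \<sigma> where "\<sigma> = 1 / sqrt (1 - c)"
  have \<sigma>: "0 < \<sigma>" "\<sigma>\<^sup>2 = 1 / (1 - c)" using assms by (auto simp: \<sigma>_def power_divide)
  have "(\<integral>\<^sup>+x. ennreal (exp (c * x\<^sup>2 / 2)) \<partial>gauss)
      = (\<integral>\<^sup>+x. ennreal (std_normal_density x) * ennreal (exp (c * x\<^sup>2 / 2)) \<partial>lborel)"
    by (simp add: nn_integral_density)
  also have "\<dots> = (\<integral>\<^sup>+x. ennreal \<sigma> * ennreal (normal_density 0 \<sigma> x) \<partial>lborel)"
  proof (rule nn_integral_cong)
    fix x :: real
    have "exp (- x\<^sup>2 / 2) * exp (c * x\<^sup>2 / 2) = exp (- (x - 0)\<^sup>2 / (2 * \<sigma>\<^sup>2))"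
      unfolding mult_exp_exp \<sigma>(2) by (rule arg_cong[of _ _ exp]) (simp add: field_simps)
    moreover have "1 / sqrt (2 * pi) = \<sigma> * (1 / sqrt (2 * pi * \<sigma>\<^sup>2))"
      using \<sigma>(1) by (simp add: real_sqrt_mult)
    moreover have "std_normal_density x * exp (c * x\<^sup>2 / 2) = 1 / sqrt (2 * pi) * (exp (- x\<^sup>2 / 2) * exp (c * x\<^sup>2 / 2))"
      by (simp add: std_normal_density_def)
    ultimately have "std_normal_density x * exp (c * x\<^sup>2 / 2) = \<sigma> * normal_density 0 \<sigma> x"
      unfolding normal_density_def by (simp only: mult.assoc)
    then show "ennreal (std_normal_density x) * ennreal (exp (c * x\<^sup>2 / 2))
        = ennreal \<sigma> * ennreal (normal_density 0 \<sigma> x)"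
      using \<sigma>(1) by (simp flip: ennreal_mult)
  qed
  also have "\<dots> = ennreal \<sigma> * ennreal (\<integral>x. normal_density 0 \<sigma> x \<partial>lborel)"
    using \<sigma>(1) by (subst nn_integral_cmult) (auto simp: nn_integral_eq_integral)
  finally show ?thesis using \<sigma>(1) by (simp add: \<sigma>_def)
qed

lemma integrable_gauss_exp_quadratic:
  assumes "c < 1" shows "integrable gauss (\<lambda>x. exp (c * x\<^sup>2 / 2))"
  using nn_integral_gauss_exp_quadratic[OF assms]
  by (subst (asm) nn_integral_eq_integrable) (use assms in auto)

lemma nn_integral_pair_mult:
  assumes "sigma_finite_measure N"
    and [measurable]: "f \<in> borel_measurable M" "g \<in> borel_measurable N"
  shows "(\<integral>\<^sup>+x. f (fst x) * g (snd x) \<partial>(M \<Otimes>\<^sub>M N)) = (\<integral>\<^sup>+x. f x \<partial>M) * (\<integral>\<^sup>+y. g y \<partial>N)"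
proof -
  interpret N: sigma_finite_measure N by fact
  show ?thesis
    by (subst N.nn_integral_fst[symmetric]) (simp_all add: nn_integral_cmult nn_integral_multc)
qed

abbreviation gauss2 :: "(real \<times> real) measure" where "gauss2 \<equiv> gauss \<Otimes>\<^sub>M gauss"
abbreviation gauss3 :: "(real \<times> real \<times> real) measure" where "gauss3 \<equiv> gauss \<Otimes>\<^sub>M gauss2"

interpretation gauss2: prob_space gauss2
  by (intro prob_space_pair gauss.prob_space_axioms)

interpretation gauss3: prob_space gauss3
  by (intro prob_space_pair gauss.prob_space_axioms gauss2.prob_space_axioms)

text \<open>Every correlation $\rho \in [0,1]$ is realised by $Z = ru + sv$ and $W = ru + sv'$ with $r^2 = \rho$ and
independent $u, v, v'$. Given the common part $u$, the variables $Z$ and $W$ are independent with the same law;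
the proof of \<open>hermite_parseval\<close> rests on this.\<close>

lemma gauss_pair_gauss3:
  assumes rs: "r\<^sup>2 + s\<^sup>2 = 1"
  shows "gauss_pair gauss3 (\<lambda>x. r * fst x + s * fst (snd x)) (\<lambda>x. r * fst x + s * snd (snd x)) (r\<^sup>2)"
proof unfold_locales
  fix a b :: real
  have "(\<integral>\<^sup>+x. ennreal (exp (a * (r * fst x + s * fst (snd x)) + b * (r * fst x + s * snd (snd x)))) \<partial>gauss3)
    = (\<integral>\<^sup>+x. ennreal (exp (((a + b) * r) * fst x))
        * (ennreal (exp ((a * s) * fst (snd x))) * ennreal (exp ((b * s) * snd (snd x)))) \<partial>gauss3)"
    by (intro nn_integral_cong)
      (simp add: exp_add[symmetric] algebra_simps flip: ennreal_mult)
  also have "\<dots> = (\<integral>\<^sup>+x. ennreal (exp (((a + b) * r) * x)) \<partial>gauss)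
     * (\<integral>\<^sup>+y. ennreal (exp ((a * s) * fst y)) * ennreal (exp ((b * s) * snd y)) \<partial>gauss2)"
    by (rule nn_integral_pair_mult) (auto intro: gauss2.sigma_finite_measure_axioms)
  also have "(\<integral>\<^sup>+y. ennreal (exp ((a * s) * fst y)) * ennreal (exp ((b * s) * snd y)) \<partial>gauss2)
     = (\<integral>\<^sup>+x. ennreal (exp ((a * s) * x)) \<partial>gauss) * (\<integral>\<^sup>+y. ennreal (exp ((b * s) * y)) \<partial>gauss)"
    by (rule nn_integral_pair_mult) (auto intro: gauss.sigma_finite_measure_axioms)
  also have "(\<integral>\<^sup>+x. ennreal (exp (((a + b) * r) * x)) \<partial>gauss) * \<dots>
    = ennreal (exp (((a + b) * r)\<^sup>2 / 2 + ((a * s)\<^sup>2 / 2 + (b * s)\<^sup>2 / 2)))"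
    unfolding nn_integral_gauss_exp_linear by (simp add: exp_add flip: ennreal_mult)
  also have "((a + b) * r)\<^sup>2 / 2 + ((a * s)\<^sup>2 / 2 + (b * s)\<^sup>2 / 2) = (a\<^sup>2 + b\<^sup>2) * (r\<^sup>2 + s\<^sup>2) / 2 + r\<^sup>2 * a * b"
    by (simp add: power2_eq_square field_simps)
  finally show "(\<integral>\<^sup>+x. ennreal (exp (a * (r * fst x + s * fst (snd x)) + b * (r * fst x + s * snd (snd x)))) \<partial>gauss3)
    = ennreal (exp ((a\<^sup>2 + b\<^sup>2) / 2 + r\<^sup>2 * a * b))"
    by (simp add: rs)
qed measurable

text \<open>Writing $e^{cz^2/2}$ as the average of $e^{\sqrt{c}\, z x}$ over a standard normal $x$ turns the
expectation into a Gaussian average of the known generating function, whose exponent is at most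
$c(1 + |\rho|)(x^2 + y^2)/2$.\<close>

lemma (in gauss_pair) integrable_exp_quadratic:
  assumes "0 \<le> c" and "c * (1 + \<bar>\<rho>\<bar>) < 1"
  shows "integrable M (\<lambda>\<omega>. exp (c * ((Z \<omega>)\<^sup>2 + (W \<omega>)\<^sup>2) / 2))"
proof (rule integrableI_nonneg)
  interpret P: pair_sigma_finite M gauss2 ..
  define h where "h = sqrt c"
  have h: "h\<^sup>2 = c" "0 \<le> h" using assms(1) by (auto simp: h_def)
  have "(\<integral>\<^sup>+\<omega>. ennreal (exp (c * ((Z \<omega>)\<^sup>2 + (W \<omega>)\<^sup>2) / 2)) \<partial>M)
    = (\<integral>\<^sup>+\<omega>. (\<integral>\<^sup>+y. ennreal (exp (h * Z \<omega> * fst y + h * W \<omega> * snd y)) \<partial>gauss2) \<partial>M)"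
  proof (rule nn_integral_cong)
    fix \<omega>
    have "(\<integral>\<^sup>+y. ennreal (exp (h * Z \<omega> * fst y + h * W \<omega> * snd y)) \<partial>gauss2)
      = (\<integral>\<^sup>+y. ennreal (exp (h * Z \<omega> * fst y)) * ennreal (exp (h * W \<omega> * snd y)) \<partial>gauss2)"
      by (simp add: exp_add flip: ennreal_mult)
    also have "\<dots> = (\<integral>\<^sup>+x. ennreal (exp ((h * Z \<omega>) * x)) \<partial>gauss) * (\<integral>\<^sup>+y. ennreal (exp ((h * W \<omega>) * y)) \<partial>gauss)"
      by (rule nn_integral_pair_mult) (auto intro: gauss.sigma_finite_measure_axioms)
    also have "\<dots> = ennreal (exp ((h * Z \<omega>)\<^sup>2 / 2 + (h * W \<omega>)\<^sup>2 / 2))"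
      unfolding nn_integral_gauss_exp_linear by (simp add: exp_add flip: ennreal_mult)
    also have "(h * Z \<omega>)\<^sup>2 / 2 + (h * W \<omega>)\<^sup>2 / 2 = c * ((Z \<omega>)\<^sup>2 + (W \<omega>)\<^sup>2) / 2"
      by (simp add: power_mult_distrib h field_simps)
    finally show "ennreal (exp (c * ((Z \<omega>)\<^sup>2 + (W \<omega>)\<^sup>2) / 2))
      = (\<integral>\<^sup>+y. ennreal (exp (h * Z \<omega> * fst y + h * W \<omega> * snd y)) \<partial>gauss2)" ..
  qed
  also have "\<dots> = (\<integral>\<^sup>+y. (\<integral>\<^sup>+\<omega>. ennreal (exp (h * Z \<omega> * fst y + h * W \<omega> * snd y)) \<partial>M) \<partial>gauss2)"
    by (rule P.Fubini'[symmetric]) measurable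
  also have "\<dots> \<le> (\<integral>\<^sup>+y. ennreal (exp ((c * (1 + \<bar>\<rho>\<bar>)) * (fst y)\<^sup>2 / 2)) * ennreal (exp ((c * (1 + \<bar>\<rho>\<bar>)) * (snd y)\<^sup>2 / 2)) \<partial>gauss2)"
  proof (rule nn_integral_mono)
    fix y :: "real \<times> real"
    define u v where "u = fst y" and "v = snd y"
    have "\<rho> * (u * v) \<le> \<bar>\<rho>\<bar> * \<bar>u * v\<bar>"
      by (metis abs_ge_self abs_mult)
    also have "\<dots> \<le> \<bar>\<rho>\<bar> * ((u\<^sup>2 + v\<^sup>2) / 2)"
      using sum_squares_bound[of "\<bar>u\<bar>" "\<bar>v\<bar>"] by (intro mult_left_mono) (auto simp: abs_mult)
    finally have "c * (\<rho> * (u * v)) \<le> c * (\<bar>\<rho>\<bar> * ((u\<^sup>2 + v\<^sup>2) / 2))"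
      using assms(1) by (rule mult_left_mono)
    then have le: "((h * u)\<^sup>2 + (h * v)\<^sup>2) / 2 + \<rho> * (h * u) * (h * v) \<le> (c * (1 + \<bar>\<rho>\<bar>)) * u\<^sup>2 / 2 + (c * (1 + \<bar>\<rho>\<bar>)) * v\<^sup>2 / 2"
      unfolding h(1)[symmetric] by (simp add: power2_eq_square field_simps)
    have "(\<integral>\<^sup>+\<omega>. ennreal (exp (h * Z \<omega> * u + h * W \<omega> * v)) \<partial>M)
        = (\<integral>\<^sup>+\<omega>. ennreal (exp (h * u * Z \<omega> + h * v * W \<omega>)) \<partial>M)"
      by (simp add: ac_simps)
    also have "\<dots> = ennreal (exp (((h * u)\<^sup>2 + (h * v)\<^sup>2) / 2 + \<rho> * (h * u) * (h * v)))"
      by (rule mgf)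
    also have "\<dots> \<le> ennreal (exp ((c * (1 + \<bar>\<rho>\<bar>)) * u\<^sup>2 / 2) * exp ((c * (1 + \<bar>\<rho>\<bar>)) * v\<^sup>2 / 2))"
      using le by (simp add: mult_exp_exp)
    finally show "(\<integral>\<^sup>+\<omega>. ennreal (exp (h * Z \<omega> * fst y + h * W \<omega> * snd y)) \<partial>M)
      \<le> ennreal (exp ((c * (1 + \<bar>\<rho>\<bar>)) * (fst y)\<^sup>2 / 2)) * ennreal (exp ((c * (1 + \<bar>\<rho>\<bar>)) * (snd y)\<^sup>2 / 2))"
      unfolding u_def v_def by (simp add: ennreal_mult)
  qed
  also have "\<dots> = (\<integral>\<^sup>+x. ennreal (exp ((c * (1 + \<bar>\<rho>\<bar>)) * x\<^sup>2 / 2)) \<partial>gauss) * (\<integral>\<^sup>+y. ennreal (exp ((c * (1 + \<bar>\<rho>\<bar>)) * y\<^sup>2 / 2)) \<partial>gauss)"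
    by (rule nn_integral_pair_mult) (auto intro: gauss.sigma_finite_measure_axioms)
  also have "\<dots> < \<infinity>"
    unfolding nn_integral_gauss_exp_quadratic[OF assms(2)] by (simp add: ennreal_mult_less_top)
  finally show "(\<integral>\<^sup>+\<omega>. ennreal (exp (c * ((Z \<omega>)\<^sup>2 + (W \<omega>)\<^sup>2) / 2)) \<partial>M) < \<infinity>" .
qed auto

section \<open>The Mehler expansion\<close>

text \<open>The majorant of the series may grow like $e^{x^2/4}$ up to an arbitrarily small loss in the exponent. The rate
$1/4$ is critical: it makes a product of two such series integrable for a pair with
$|\rho| < 1$, whereas the square of one series in a single standard normal variable may fail to be integrable.\<close>

definition subgaussian_series :: "(nat \<Rightarrow> real) \<Rightarrow> bool" where
  "subgaussian_series b \<longleftrightarrow> (\<forall>\<theta>>1. \<exists>C. \<forall>x.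
     summable (\<lambda>p. \<bar>b p\<bar> * \<bar>x\<bar> ^ p) \<and> (\<Sum>p. \<bar>b p\<bar> * \<bar>x\<bar> ^ p) \<le> C * exp (\<theta> * x\<^sup>2 / 4))"

definition series_fun :: "(nat \<Rightarrow> real) \<Rightarrow> real \<Rightarrow> real" where
  "series_fun b x = (\<Sum>p. b p * x ^ p)"

text \<open>The expectation of \<open>series_fun b Z\<close> times the $k$-th Hermite polynomial of $Z$, computed term by term.\<close>

definition hermite_coeff :: "(nat \<Rightarrow> real) \<Rightarrow> nat \<Rightarrow> real" where
  "hermite_coeff b k = (\<Sum>p. b p * hermite_moment p k)"

lemma subgaussian_summable:
  assumes "subgaussian_series b"
  shows "summable (\<lambda>p. \<bar>b p\<bar> * \<bar>x\<bar> ^ p)"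
proof -
  have "(1::real) < 2" by simp
  then show ?thesis using assms unfolding subgaussian_series_def by metis
qed

lemma series_fun_sums:
  assumes "subgaussian_series b"
  shows "(\<lambda>p. b p * x ^ p) sums series_fun b x"
proof -
  have "summable (\<lambda>p. norm (b p * x ^ p))"
    using subgaussian_summable[OF assms, of x] by (simp add: abs_mult power_abs)
  then show ?thesis
    unfolding series_fun_def by (rule summable_sums[OF summable_norm_cancel])
qed

lemma series_fun_partial_le:
  assumes "subgaussian_series b"
  shows "\<bar>\<Sum>p<N. b p * x ^ p\<bar> \<le> (\<Sum>p. \<bar>b p\<bar> * \<bar>x\<bar> ^ p)"
    and "(\<Sum>p<N. \<bar>b p\<bar> * \<bar>x\<bar> ^ p) \<le> (\<Sum>p. \<bar>b p\<bar> * \<bar>x\<bar> ^ p)"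
proof -
  show 1: "(\<Sum>p<N. \<bar>b p\<bar> * \<bar>x\<bar> ^ p) \<le> (\<Sum>p. \<bar>b p\<bar> * \<bar>x\<bar> ^ p)"
    using sum_le_suminf[OF subgaussian_summable[OF assms, of x], of "{..<N}"] by simp
  have "\<bar>\<Sum>p<N. b p * x ^ p\<bar> \<le> (\<Sum>p<N. \<bar>b p\<bar> * \<bar>x\<bar> ^ p)"
    using sum_abs[of "\<lambda>p. b p * x ^ p" "{..<N}"] by (simp add: abs_mult power_abs)
  with 1 show "\<bar>\<Sum>p<N. b p * x ^ p\<bar> \<le> (\<Sum>p. \<bar>b p\<bar> * \<bar>x\<bar> ^ p)" by simp
qed

lemma series_fun_abs_le:
  assumes "subgaussian_series b"
  shows "\<bar>series_fun b x\<bar> \<le> (\<Sum>p. \<bar>b p\<bar> * \<bar>x\<bar> ^ p)"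
  using series_fun_sums[OF assms, of x] series_fun_partial_le(1)[OF assms, of x]
  by (intro Lim_bounded[OF tendsto_rabs]) (auto simp: sums_def)

lemma series_fun_measurable [measurable]:
  assumes "subgaussian_series b"
  shows "series_fun b \<in> borel_measurable borel"
  by (rule borel_measurable_LIMSEQ_metric[of "\<lambda>N x. \<Sum>p<N. b p * x ^ p"])
    (use series_fun_sums[OF assms] in \<open>auto simp: sums_def\<close>)

lemma series_fun_continuous:
  assumes "subgaussian_series b"
  shows "isCont (series_fun b) x"
  unfolding series_fun_def
  by (rule isCont_powser_converges_everywhere) (use series_fun_sums[OF assms] in \<open>auto simp: sums_iff\<close>)

lemma subgaussian_monomial: "subgaussian_series (\<lambda>p. if p = k then 1 else 0)"
  unfolding subgaussian_series_def
proof (intro allI impI exI conjI)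
  fix \<theta> x :: real
  assume "1 < \<theta>"
  have eq: "(\<lambda>p. \<bar>if p = k then 1 else 0\<bar> * \<bar>x\<bar> ^ p) = (\<lambda>p. if p = k then \<bar>x\<bar> ^ k else 0)"
    by auto
  show "summable (\<lambda>p. \<bar>if p = k then 1 else 0\<bar> * \<bar>x\<bar> ^ p)"
    unfolding eq by simp
  have "0 \<le> (\<bar>x\<bar> / 2 - 1)\<^sup>2" by simp
  then have "\<bar>x\<bar> \<le> 1 + x\<^sup>2 / 4" by (simp add: power2_eq_square field_simps)
  also have "\<dots> \<le> 1 + \<theta> * x\<^sup>2 / 4" using \<open>1 < \<theta>\<close> by (simp add: mult_le_cancel_right1)
  finally have "exp \<bar>x\<bar> \<le> exp 1 * exp (\<theta> * x\<^sup>2 / 4)" by (simp add: mult_exp_exp)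
  then have "\<bar>x\<bar> ^ k \<le> fact k * (exp 1 * exp (\<theta> * x\<^sup>2 / 4))"
    by (intro order_trans[OF power_le_fact_exp] mult_left_mono) auto
  then show "(\<Sum>p. \<bar>if p = k then 1 else 0\<bar> * \<bar>x\<bar> ^ p) \<le> (fact k * exp 1) * exp (\<theta> * x\<^sup>2 / 4)"
    unfolding eq using sums_unique[OF sums_single[where i = k and f = "\<lambda>_. \<bar>x\<bar> ^ k"]] by (simp add: mult.assoc)
qed

context gauss_pair
begin

lemma majorant_product_integrable:
  assumes b: "subgaussian_series b" and b': "subgaussian_series b'" and \<rho>: "\<bar>\<rho>\<bar> < 1"
  obtains w where "integrable M w"
    and "\<And>\<omega>. (\<Sum>p. \<bar>b p\<bar> * \<bar>Z \<omega>\<bar> ^ p) * (\<Sum>q. \<bar>b' q\<bar> * \<bar>W \<omega>\<bar> ^ q) \<le> w \<omega>"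
proof -
  have "1 < 2 / (1 + \<bar>\<rho>\<bar>)" using \<rho> by simp
  \<comment> \<open>The upper bound on $\theta$ is the integrability condition $(\theta/2)(1 + |\rho|) < 1$; there is room above $1$ because $|\rho| < 1$.\<close>
  then obtain \<theta> where \<theta>: "1 < \<theta>" "\<theta> < 2 / (1 + \<bar>\<rho>\<bar>)" using dense by blast
  then have lt: "\<theta> / 2 * (1 + \<bar>\<rho>\<bar>) < 1" by (simp add: pos_less_divide_eq)
  obtain C where C: "\<And>x. (\<Sum>p. \<bar>b p\<bar> * \<bar>x\<bar> ^ p) \<le> C * exp (\<theta> * x\<^sup>2 / 4)"
    using b \<theta>(1) unfolding subgaussian_series_def by metis
  obtain D where D: "\<And>x. (\<Sum>p. \<bar>b' p\<bar> * \<bar>x\<bar> ^ p) \<le> D * exp (\<theta> * x\<^sup>2 / 4)"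
    using b' \<theta>(1) unfolding subgaussian_series_def by metis
  show thesis
  proof (rule that)
    show "integrable M (\<lambda>\<omega>. C * D * exp (\<theta> / 2 * ((Z \<omega>)\<^sup>2 + (W \<omega>)\<^sup>2) / 2))"
      using \<theta>(1) lt by (intro Bochner_Integration.integrable_mult_right integrable_exp_quadratic) auto
    fix \<omega>
    have nn: "0 \<le> (\<Sum>p. \<bar>b p\<bar> * \<bar>x\<bar> ^ p)" "0 \<le> (\<Sum>p. \<bar>b' p\<bar> * \<bar>x\<bar> ^ p)" for x
      by (rule suminf_nonneg[OF subgaussian_summable[OF b]], simp)
        (rule suminf_nonneg[OF subgaussian_summable[OF b']], simp)
    have "(\<Sum>p. \<bar>b p\<bar> * \<bar>Z \<omega>\<bar> ^ p) * (\<Sum>q. \<bar>b' q\<bar> * \<bar>W \<omega>\<bar> ^ q)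
      \<le> (C * exp (\<theta> * (Z \<omega>)\<^sup>2 / 4)) * (D * exp (\<theta> * (W \<omega>)\<^sup>2 / 4))"
      using nn C[of "Z \<omega>"] by (intro mult_mono C D) (auto intro: order_trans)
    also have "\<dots> = C * D * (exp (\<theta> * (Z \<omega>)\<^sup>2 / 4) * exp (\<theta> * (W \<omega>)\<^sup>2 / 4))"
      by simp
    also have "exp (\<theta> * (Z \<omega>)\<^sup>2 / 4) * exp (\<theta> * (W \<omega>)\<^sup>2 / 4) = exp (\<theta> / 2 * ((Z \<omega>)\<^sup>2 + (W \<omega>)\<^sup>2) / 2)"
      by (simp add: mult_exp_exp field_simps)
    finally show "(\<Sum>p. \<bar>b p\<bar> * \<bar>Z \<omega>\<bar> ^ p) * (\<Sum>q. \<bar>b' q\<bar> * \<bar>W \<omega>\<bar> ^ q)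
      \<le> C * D * exp (\<theta> / 2 * ((Z \<omega>)\<^sup>2 + (W \<omega>)\<^sup>2) / 2)" .
  qed
qed

lemma expectation_polynomial_product:
  "integrable M (\<lambda>\<omega>. (\<Sum>p<N. b p * Z \<omega> ^ p) * (\<Sum>q<N. b' q * W \<omega> ^ q))"
  "(\<integral>\<omega>. (\<Sum>p<N. b p * Z \<omega> ^ p) * (\<Sum>q<N. b' q * W \<omega> ^ q) \<partial>M)
     = (\<Sum>k<N. \<Sum>p<N. \<Sum>q<N. b p * b' q * hermite_moment p k * hermite_moment q k * \<rho> ^ k / fact k)"
proof -
  have eq: "(\<Sum>p<N. b p * Z \<omega> ^ p) * (\<Sum>q<N. b' q * W \<omega> ^ q)
    = (\<Sum>p<N. \<Sum>q<N. b p * b' q * (Z \<omega> ^ p * W \<omega> ^ q))" for \<omega>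
    unfolding sum_product by (intro sum.cong) auto
  show "integrable M (\<lambda>\<omega>. (\<Sum>p<N. b p * Z \<omega> ^ p) * (\<Sum>q<N. b' q * W \<omega> ^ q))"
    unfolding eq
    by (intro Bochner_Integration.integrable_sum Bochner_Integration.integrable_mult_right integrable_moment)
  have "(\<integral>\<omega>. (\<Sum>p<N. b p * Z \<omega> ^ p) * (\<Sum>q<N. b' q * W \<omega> ^ q) \<partial>M)
    = (\<Sum>p<N. \<Sum>q<N. b p * b' q * (\<integral>\<omega>. Z \<omega> ^ p * W \<omega> ^ q \<partial>M))"
    unfolding eq using integrable_moment
    by (simp add: Bochner_Integration.integral_sum Bochner_Integration.integrable_sum)
  also have "\<dots> = (\<Sum>p<N. \<Sum>q<N. \<Sum>k<N. b p * b' q * hermite_moment p k * hermite_moment q k * \<rho> ^ k / fact k)"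
  proof (intro sum.cong refl)
    fix p q assume "p \<in> {..<N}"
    have "(\<Sum>k\<le>p. hermite_moment p k * hermite_moment q k * \<rho> ^ k / fact k)
        = (\<Sum>k<N. hermite_moment p k * hermite_moment q k * \<rho> ^ k / fact k)"
      by (rule sum.mono_neutral_left) (use \<open>p \<in> {..<N}\<close> in \<open>auto simp: hermite_moment_eq_0\<close>)
    then show "b p * b' q * (\<integral>\<omega>. Z \<omega> ^ p * W \<omega> ^ q \<partial>M)
        = (\<Sum>k<N. b p * b' q * hermite_moment p k * hermite_moment q k * \<rho> ^ k / fact k)"
      by (simp add: mixed_moment_eq sum_distrib_left mult.assoc)
  qed
  also have "\<dots> = (\<Sum>p<N. \<Sum>k<N. \<Sum>q<N. b p * b' q * hermite_moment p k * hermite_moment q k * \<rho> ^ k / fact k)"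
    by (intro sum.cong refl sum.swap)
  also have "\<dots> = (\<Sum>k<N. \<Sum>p<N. \<Sum>q<N. b p * b' q * hermite_moment p k * hermite_moment q k * \<rho> ^ k / fact k)"
    by (rule sum.swap)
  finally show "(\<integral>\<omega>. (\<Sum>p<N. b p * Z \<omega> ^ p) * (\<Sum>q<N. b' q * W \<omega> ^ q) \<partial>M)
     = (\<Sum>k<N. \<Sum>p<N. \<Sum>q<N. b p * b' q * hermite_moment p k * hermite_moment q k * \<rho> ^ k / fact k)" .
qed

lemma
  assumes b: "subgaussian_series b" and b': "subgaussian_series b'" and \<rho>: "\<bar>\<rho>\<bar> < 1"
  shows integrable_series_product: "integrable M (\<lambda>\<omega>. series_fun b (Z \<omega>) * series_fun b' (W \<omega>))" (is ?A)
    and expectation_series_product_LIMSEQ: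
      "(\<lambda>N. \<Sum>k<N. \<Sum>p<N. \<Sum>q<N. b p * b' q * hermite_moment p k * hermite_moment q k * \<rho> ^ k / fact k)
         \<longlonglongrightarrow> (\<integral>\<omega>. series_fun b (Z \<omega>) * series_fun b' (W \<omega>) \<partial>M)" (is ?B)
proof -
  note [measurable] = series_fun_measurable[OF b] series_fun_measurable[OF b']
  obtain w where w: "integrable M w"
    and le: "\<And>\<omega>. (\<Sum>p. \<bar>b p\<bar> * \<bar>Z \<omega>\<bar> ^ p) * (\<Sum>q. \<bar>b' q\<bar> * \<bar>W \<omega>\<bar> ^ q) \<le> w \<omega>"
    using majorant_product_integrable[OF b b' \<rho>] by blast
  have lim: "AE \<omega> in M. (\<lambda>N. (\<Sum>p<N. b p * Z \<omega> ^ p) * (\<Sum>q<N. b' q * W \<omega> ^ q))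
      \<longlonglongrightarrow> series_fun b (Z \<omega>) * series_fun b' (W \<omega>)"
    using series_fun_sums[OF b] series_fun_sums[OF b'] by (intro AE_I2 tendsto_mult) (auto simp: sums_def)
  have bd: "AE \<omega> in M. norm ((\<Sum>p<N. b p * Z \<omega> ^ p) * (\<Sum>q<N. b' q * W \<omega> ^ q)) \<le> w \<omega>" for N
  proof (rule AE_I2)
    fix \<omega>
    have "norm ((\<Sum>p<N. b p * Z \<omega> ^ p) * (\<Sum>q<N. b' q * W \<omega> ^ q))
        \<le> (\<Sum>p. \<bar>b p\<bar> * \<bar>Z \<omega>\<bar> ^ p) * (\<Sum>q. \<bar>b' q\<bar> * \<bar>W \<omega>\<bar> ^ q)"
      unfolding real_norm_def abs_mult[of "sum _ _"]
      by (intro mult_mono series_fun_partial_le b b' suminf_nonneg subgaussian_summable) auto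
    also note le
    finally show "norm ((\<Sum>p<N. b p * Z \<omega> ^ p) * (\<Sum>q<N. b' q * W \<omega> ^ q)) \<le> w \<omega>" .
  qed
  show ?A
    by (rule integrable_dominated_convergence[OF _ _ w lim bd]) measurable
  have "(\<lambda>N. \<integral>\<omega>. (\<Sum>p<N. b p * Z \<omega> ^ p) * (\<Sum>q<N. b' q * W \<omega> ^ q) \<partial>M)
      \<longlonglongrightarrow> (\<integral>\<omega>. series_fun b (Z \<omega>) * series_fun b' (W \<omega>) \<partial>M)"
    by (rule integral_dominated_convergence[OF _ _ w lim bd]) measurable
  then show ?B unfolding expectation_polynomial_product(2) .
qed

text \<open>For a pair with $\rho \ge 0$ all the terms are nonnegative, because \<open>hermite_moment\<close> is, and the bound
becomes absolute convergence.\<close>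

lemma polynomial_product_bounded:
  assumes b: "subgaussian_series b" and b': "subgaussian_series b'" and \<rho>: "\<bar>\<rho>\<bar> < 1"
  obtains B where "\<And>N. (\<Sum>k<N. \<Sum>p<N. \<Sum>q<N.
     \<bar>b p\<bar> * \<bar>b' q\<bar> * hermite_moment p k * hermite_moment q k * \<rho> ^ k / fact k) \<le> B"
proof -
  obtain w where w: "integrable M w"
    and le: "\<And>\<omega>. (\<Sum>p. \<bar>b p\<bar> * \<bar>Z \<omega>\<bar> ^ p) * (\<Sum>q. \<bar>b' q\<bar> * \<bar>W \<omega>\<bar> ^ q) \<le> w \<omega>"
    using majorant_product_integrable[OF b b' \<rho>] by blast
  have "(\<Sum>k<N. \<Sum>p<N. \<Sum>q<N.
     \<bar>b p\<bar> * \<bar>b' q\<bar> * hermite_moment p k * hermite_moment q k * \<rho> ^ k / fact k) \<le> (\<integral>\<omega>. w \<omega> \<partial>M)" for N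
    unfolding expectation_polynomial_product(2)[symmetric]
  proof (rule integral_mono[OF expectation_polynomial_product(1) w])
    fix \<omega>
    have "(\<Sum>p<N. \<bar>b p\<bar> * Z \<omega> ^ p) * (\<Sum>q<N. \<bar>b' q\<bar> * W \<omega> ^ q)
      \<le> \<bar>\<Sum>p<N. \<bar>b p\<bar> * Z \<omega> ^ p\<bar> * \<bar>\<Sum>q<N. \<bar>b' q\<bar> * W \<omega> ^ q\<bar>"
      unfolding abs_mult[symmetric] by simp
    also have "\<dots> \<le> (\<Sum>p<N. \<bar>\<bar>b p\<bar> * Z \<omega> ^ p\<bar>) * (\<Sum>q<N. \<bar>\<bar>b' q\<bar> * W \<omega> ^ q\<bar>)"
      by (intro mult_mono sum_abs) (auto intro: sum_nonneg)
    also have "\<dots> \<le> (\<Sum>p. \<bar>b p\<bar> * \<bar>Z \<omega>\<bar> ^ p) * (\<Sum>q. \<bar>b' q\<bar> * \<bar>W \<omega>\<bar> ^ q)"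
      unfolding abs_mult abs_abs power_abs
      by (intro mult_mono series_fun_partial_le b b' suminf_nonneg subgaussian_summable sum_nonneg) auto
    also note le
    finally show "(\<Sum>p<N. \<bar>b p\<bar> * Z \<omega> ^ p) * (\<Sum>q<N. \<bar>b' q\<bar> * W \<omega> ^ q) \<le> w \<omega>" .
  qed
  then show thesis by (rule that)
qed

end

text \<open>The finite sums for $|\rho|$ in place of $\rho$ are expectations for a pair with correlation $|\rho|$, and these are
bounded by the integral of the majorant.\<close>

lemma mehler_abs_summable:
  assumes b: "subgaussian_series b" and b': "subgaussian_series b'" and \<rho>: "\<bar>\<rho>\<bar> < 1"
  shows "(\<lambda>(k, p, q). \<bar>b p * b' q * hermite_moment p k * hermite_moment q k * \<rho> ^ k / fact k\<bar>) summable_on UNIV"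
proof (rule nonneg_bdd_above_summable_on)
  have "(sqrt \<bar>\<rho>\<bar>)\<^sup>2 + (sqrt (1 - \<bar>\<rho>\<bar>))\<^sup>2 = 1" using \<rho> by simp
  then interpret P: gauss_pair gauss3
    "\<lambda>x. sqrt \<bar>\<rho>\<bar> * fst x + sqrt (1 - \<bar>\<rho>\<bar>) * fst (snd x)"
    "\<lambda>x. sqrt \<bar>\<rho>\<bar> * fst x + sqrt (1 - \<bar>\<rho>\<bar>) * snd (snd x)" "\<bar>\<rho>\<bar>"
    using gauss_pair_gauss3 by fastforce
  define T where "T = (\<lambda>(k, p, q). \<bar>b p * b' q * hermite_moment p k * hermite_moment q k * \<rho> ^ k / fact k\<bar>)"
  obtain B where B: "\<And>N. (\<Sum>k<N. \<Sum>p<N. \<Sum>q<N.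
     \<bar>b p\<bar> * \<bar>b' q\<bar> * hermite_moment p k * hermite_moment q k * \<bar>\<rho>\<bar> ^ k / fact k) \<le> B"
    by (rule P.polynomial_product_bounded[OF b b']) (use \<rho> in auto)
  have T_nonneg: "0 \<le> T x" for x by (auto simp: T_def split: prod.split)
  show "bdd_above (sum T ` {F. F \<subseteq> UNIV \<and> finite F})"
  proof (rule bdd_aboveI2)
    fix F :: "(nat \<times> nat \<times> nat) set" assume "F \<in> {F. F \<subseteq> UNIV \<and> finite F}"
    then have fin: "finite F" by simp
    then obtain N where N: "fst ` F \<union> (fst \<circ> snd) ` F \<union> (snd \<circ> snd) ` F \<subseteq> {..<N}"
      using finite_nat_iff_bounded by (metis finite_UnI finite_imageI)
    then have "F \<subseteq> {..<N} \<times> {..<N} \<times> {..<N}" by force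
    then have "sum T F \<le> sum T ({..<N} \<times> {..<N} \<times> {..<N})"
      by (intro sum_mono2) (auto intro: T_nonneg)
    also have "\<dots> = (\<Sum>k<N. \<Sum>p<N. \<Sum>q<N.
       \<bar>b p\<bar> * \<bar>b' q\<bar> * hermite_moment p k * hermite_moment q k * \<bar>\<rho>\<bar> ^ k / fact k)"
      by (simp add: T_def sum.cartesian_product[symmetric] abs_mult power_abs hermite_moment_nonneg)
    also note B
    finally show "sum T F \<le> B" .
  qed
  show "0 \<le> T x" for x by (rule T_nonneg)
qed

text \<open>A single monomial is a \<open>subgaussian_series\<close>. Pairing $b$ with $x^k$ under correlation $1/2$ and keeping only the
indices $(k, p, k)$ of the triple sum leaves a constant multiple of the series in question.\<close>

lemma hermite_coeff_abs_summable:
  assumes b: "subgaussian_series b"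
  shows "summable (\<lambda>p. \<bar>b p * hermite_moment p k\<bar>)"
proof -
  let ?T = "\<lambda>(k', p, q). \<bar>b p * (if q = k then 1 else 0) * hermite_moment p k' * hermite_moment q k' * (1/2) ^ k' / fact k'\<bar>"
  have "?T summable_on UNIV"
    by (rule mehler_abs_summable[OF b subgaussian_monomial]) simp
  then have "?T summable_on range (\<lambda>p. (k, p, k))"
    by (rule summable_on_subset_banach) simp
  then have "(?T \<circ> (\<lambda>p. (k, p, k))) summable_on UNIV"
    by (subst (asm) summable_on_reindex) (auto simp: inj_on_def)
  moreover have "?T \<circ> (\<lambda>p. (k, p, k)) = (\<lambda>p. \<bar>b p * hermite_moment p k\<bar> * (1/2) ^ k)"
  proof
    have "hermite_moment k k = fact k"
      using normal_moment_even[of 0] by (simp add: hermite_moment_def)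
    then show "(?T \<circ> (\<lambda>p. (k, p, k))) p = \<bar>b p * hermite_moment p k\<bar> * (1/2) ^ k" for p
      by (simp add: abs_mult)
  qed
  ultimately have "summable (\<lambda>p. \<bar>b p * hermite_moment p k\<bar> * (1/2) ^ k)"
    by (simp add: summable_on_UNIV_nonneg_real_iff)
  from summable_mult2[OF this, of "2 ^ k"] show ?thesis
    by (simp add: mult.assoc flip: power_mult_distrib)
qed

lemma hermite_coeff_has_sum:
  assumes b: "subgaussian_series b"
  shows "((\<lambda>p. b p * hermite_moment p k) has_sum hermite_coeff b k) UNIV"
  unfolding hermite_coeff_def
proof (rule norm_summable_imp_has_sum)
  show *: "summable (\<lambda>p. norm (b p * hermite_moment p k))"
    using hermite_coeff_abs_summable[OF b, of k] by simp
  show "(\<lambda>p. b p * hermite_moment p k) sums (\<Sum>p. b p * hermite_moment p k)"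
    by (rule summable_sums[OF summable_norm_cancel[OF *]])
qed

text \<open>The expectation is the limit of the triple sum over growing cubes; by absolute convergence this is also the sum
taken over $p$ and $q$ first, where it factorises.\<close>

theorem (in gauss_pair) mehler_expansion:
  assumes b: "subgaussian_series b" and b': "subgaussian_series b'" and \<rho>: "\<bar>\<rho>\<bar> < 1"
  shows "(\<lambda>k. hermite_coeff b k * hermite_coeff b' k * \<rho> ^ k / fact k)
           sums (\<integral>\<omega>. series_fun b (Z \<omega>) * series_fun b' (W \<omega>) \<partial>M)"
proof -
  define T where "T = (\<lambda>(k, p, q). b p * b' q * hermite_moment p k * hermite_moment q k * \<rho> ^ k / fact k)"
  have "(\<lambda>x. norm (T x)) summable_on UNIV"
    using mehler_abs_summable[OF b b' \<rho>] by (simp add: T_def case_prod_unfold)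
  then have T: "T summable_on UNIV" by (rule abs_summable_summable)
  then obtain S where S: "(T has_sum S) UNIV" by (auto simp: summable_on_def)
  have "(\<lambda>N. sum T ({..<N} \<times> {..<N} \<times> {..<N})) \<longlonglongrightarrow> S"
  proof -
    have "filterlim (\<lambda>N::nat. {..<N} \<times> {..<N} \<times> {..<N}) (finite_subsets_at_top UNIV) sequentially"
      unfolding filterlim_finite_subsets_at_top
    proof (intro allI impI)
      fix F :: "(nat \<times> nat \<times> nat) set" assume "finite F \<and> F \<subseteq> UNIV"
      then have fin: "finite F" by simp
      then obtain N where N: "fst ` F \<union> (fst \<circ> snd) ` F \<union> (snd \<circ> snd) ` F \<subseteq> {..<N}"
        using finite_nat_iff_bounded by (metis finite_UnI finite_imageI)
      then have sub: "F \<subseteq> {..<N} \<times> {..<N} \<times> {..<N}" by force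
      show "\<forall>\<^sub>F n in sequentially. finite ({..<n} \<times> {..<n} \<times> {..<n}) \<and> F \<subseteq> {..<n} \<times> {..<n} \<times> {..<n}
          \<and> {..<n} \<times> {..<n} \<times> {..<n} \<subseteq> UNIV"
        using eventually_ge_at_top[of N]
      proof eventually_elim
        case (elim n)
        then show ?case using sub by fastforce
      qed
    qed
    with S show ?thesis unfolding has_sum_def by (rule filterlim_compose)
  qed
  moreover have "sum T ({..<N} \<times> {..<N} \<times> {..<N}) = (\<Sum>k<N. \<Sum>p<N. \<Sum>q<N. b p * b' q * hermite_moment p k * hermite_moment q k * \<rho> ^ k / fact k)" for N
    by (simp add: T_def sum.cartesian_product[symmetric])
  ultimately have S_eq: "S = (\<integral>\<omega>. series_fun b (Z \<omega>) * series_fun b' (W \<omega>) \<partial>M)"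
    using expectation_series_product_LIMSEQ[OF b b' \<rho>] LIMSEQ_unique by auto
  have "((\<lambda>k. hermite_coeff b k * hermite_coeff b' k * \<rho> ^ k / fact k) has_sum S) UNIV"
  proof (rule has_sum_SigmaD)
    show "(T has_sum S) (Sigma UNIV (\<lambda>_. UNIV))" using S by simp
    fix k :: nat
    have "(\<lambda>y. T (k, y)) summable_on UNIV"
      using summable_on_SigmaD1[of "\<lambda>x y. T (x, y)" UNIV "\<lambda>_. UNIV" k] T by simp
    then obtain s where s: "((\<lambda>y. T (k, y)) has_sum s) UNIV" by (auto simp: summable_on_def)
    have "((\<lambda>p. b p * hermite_moment p k * (hermite_coeff b' k * \<rho> ^ k / fact k)) has_sum s) UNIV"
    proof (rule has_sum_SigmaD)
      show "((\<lambda>y. T (k, y)) has_sum s) (Sigma UNIV (\<lambda>_. UNIV))" using s by simp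
      fix p :: nat
      have "((\<lambda>q. (b p * hermite_moment p k * \<rho> ^ k / fact k) * (b' q * hermite_moment q k))
          has_sum (b p * hermite_moment p k * \<rho> ^ k / fact k) * hermite_coeff b' k) UNIV"
        by (intro has_sum_cmult_right hermite_coeff_has_sum b')
      then show "((\<lambda>q. T (k, p, q)) has_sum b p * hermite_moment p k * (hermite_coeff b' k * \<rho> ^ k / fact k)) UNIV"
        by (simp add: T_def ac_simps)
    qed
    moreover have "((\<lambda>p. b p * hermite_moment p k * (hermite_coeff b' k * \<rho> ^ k / fact k))
        has_sum hermite_coeff b k * (hermite_coeff b' k * \<rho> ^ k / fact k)) UNIV"
      by (intro has_sum_cmult_left hermite_coeff_has_sum b)
    ultimately have "s = hermite_coeff b k * (hermite_coeff b' k * \<rho> ^ k / fact k)"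
      by (rule has_sum_unique)
    then show "((\<lambda>y. T (k, y)) has_sum hermite_coeff b k * hermite_coeff b' k * \<rho> ^ k / fact k) UNIV"
      using s by (simp add: mult.assoc)
  qed
  then show ?thesis unfolding S_eq by (rule has_sum_imp_sums)
qed

section \<open>Perfect correlation: the Parseval identity\<close>

lemma integral_pair_mult:
  fixes f g :: "_ \<Rightarrow> real"
  assumes "sigma_finite_measure M" "sigma_finite_measure N"
    and f: "integrable M f" and g: "integrable N g"
  shows "(\<integral>x. f (fst x) * g (snd x) \<partial>(M \<Otimes>\<^sub>M N)) = (\<integral>x. f x \<partial>M) * (\<integral>y. g y \<partial>N)"
proof -
  interpret M: sigma_finite_measure M by fact
  interpret N: sigma_finite_measure N by fact
  interpret pair_sigma_finite M N ..
  have [measurable]: "f \<in> borel_measurable M" "g \<in> borel_measurable N"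
    using f g by auto
  have "integrable (M \<Otimes>\<^sub>M N) (\<lambda>x. f (fst x) * g (snd x))"
    by (rule Fubini_integrable) (use f g in \<open>auto simp: abs_mult\<close>)
  from integral_fst'[OF this] show ?thesis by simp
qed

text \<open>As $(ru + sv)^2 \le u^2 + v^2$ on the unit circle, the bound is uniform in $(r,s)$, and it is integrable in $v$.
The value $3/2$ used in the proof is an arbitrary
admissible growth rate between $1$ and $2$.\<close>

lemma subgaussian_bound_smoothed:
  assumes b: "subgaussian_series b"
  obtains C where "\<And>r s u v. r\<^sup>2 + s\<^sup>2 = 1 \<Longrightarrow>
    \<bar>series_fun b (r * u + s * v)\<bar> \<le> C * exp (3 * u\<^sup>2 / 8) * exp (3 / 4 * v\<^sup>2 / 2)"
proof -
  obtain C where C: "\<And>x. (\<Sum>p. \<bar>b p\<bar> * \<bar>x\<bar> ^ p) \<le> C * exp (3 / 2 * x\<^sup>2 / 4)"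
    using b[unfolded subgaussian_series_def, rule_format, of "3 / 2"] by auto
  have "0 \<le> \<bar>series_fun b 0\<bar>" by simp
  also have "\<dots> \<le> C" using series_fun_abs_le[OF b, of 0] C[of 0] by simp
  finally have C0: "0 \<le> C" .
  show thesis
  proof (rule that)
    fix r s u v :: real
    assume rs: "r\<^sup>2 + s\<^sup>2 = 1"
    have "(r * u + s * v)\<^sup>2 + (r * v - s * u)\<^sup>2 = (r\<^sup>2 + s\<^sup>2) * (u\<^sup>2 + v\<^sup>2)"
      by (simp add: power2_eq_square algebra_simps)
    then have le: "(r * u + s * v)\<^sup>2 \<le> u\<^sup>2 + v\<^sup>2"
      unfolding rs mult_1 using zero_le_power2[of "r * v - s * u"] by linarith
    have "\<bar>series_fun b (r * u + s * v)\<bar> \<le> C * exp (3 / 2 * (r * u + s * v)\<^sup>2 / 4)"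
      using series_fun_abs_le[OF b] C by (rule order_trans)
    also have "\<dots> \<le> C * exp (3 * u\<^sup>2 / 8 + 3 / 4 * v\<^sup>2 / 2)"
      using C0 le by (intro mult_left_mono) auto
    finally show "\<bar>series_fun b (r * u + s * v)\<bar> \<le> C * exp (3 * u\<^sup>2 / 8) * exp (3 / 4 * v\<^sup>2 / 2)"
      by (simp add: exp_add)
  qed
qed

text \<open>Take pairs with correlation $r_n^2 \to 1$. Mehler's formula evaluates $A_n = E[\varphi(Z_n)\varphi(W_n)]$, and $A_n$ is
at most the second moment $I$ of $\varphi$, which gives one inequality. On the other hand $A_n$ is
the second moment of the average $P_n \varphi(u) = E[\varphi(r_n u + s_n v)]$, and $P_n \varphi \to \varphi$ pointwise, so
Fatou's lemma gives $I \le \liminf A_n$.\<close>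

theorem hermite_parseval:
  assumes b: "subgaussian_series b" and int: "integrable gauss (\<lambda>x. (series_fun b x)\<^sup>2)"
  shows "(\<lambda>k. (hermite_coeff b k)\<^sup>2 / fact k) sums (\<integral>x. (series_fun b x)\<^sup>2 \<partial>gauss)"
proof -
  note [measurable] = series_fun_measurable[OF b]
  define \<phi> where "\<phi> = series_fun b"
  have \<phi>_meas [measurable]: "\<phi> \<in> borel_measurable borel" unfolding \<phi>_def by measurable
  define h where "h k = (hermite_coeff b k)\<^sup>2 / fact k" for k
  have h_nonneg: "0 \<le> h k" for k by (simp add: h_def)
  define I where "I = (\<integral>x. (\<phi> x)\<^sup>2 \<partial>gauss)"
  define r :: "nat \<Rightarrow> real" where "r n = real n / real (Suc n)" for n
  define s where "s n = sqrt (1 - (r n)\<^sup>2)" for n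
  have r: "0 \<le> r n" "r n < 1" for n by (auto simp: r_def)
  have r2: "(r n)\<^sup>2 < 1" for n using r[of n] by (simp add: abs_square_less_1)
  have rs: "(r n)\<^sup>2 + (s n)\<^sup>2 = 1" for n using r2[of n] by (simp add: s_def)
  have r_lim: "r \<longlonglongrightarrow> 1" unfolding r_def by (rule LIMSEQ_n_over_Suc_n)
  have "(\<lambda>n. sqrt (1 - (r n)\<^sup>2)) \<longlonglongrightarrow> sqrt (1 - 1\<^sup>2)"
    by (intro tendsto_intros r_lim)
  then have s_lim: "s \<longlonglongrightarrow> 0" by (simp add: s_def[abs_def])
  define Z where "Z n x = r n * fst x + s n * fst (snd x)" for n and x :: "real \<times> real \<times> real"
  define W where "W n x = r n * fst x + s n * snd (snd x)" for n and x :: "real \<times> real \<times> real"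
  have ZW: "gauss_pair gauss3 (Z n) (W n) ((r n)\<^sup>2)" for n
    unfolding Z_def W_def by (rule gauss_pair_gauss3[OF rs])
  have [measurable]: "Z n \<in> borel_measurable gauss3" "W n \<in> borel_measurable gauss3" for n
    using ZW[of n] by (auto dest: gauss_pair.Z_measurable gauss_pair.W_measurable)
  define A where "A n = (\<integral>x. \<phi> (Z n x) * \<phi> (W n x) \<partial>gauss3)" for n
  have A_int: "integrable gauss3 (\<lambda>x. \<phi> (Z n x) * \<phi> (W n x))" for n
    unfolding \<phi>_def using r2[of n] by (intro gauss_pair.integrable_series_product[OF ZW b b]) auto
  have A_sums: "(\<lambda>k. h k * (r n)\<^sup>2 ^ k) sums A n" for n
  proof -
    have "(\<lambda>k. hermite_coeff b k * hermite_coeff b k * (r n)\<^sup>2 ^ k / fact k) sums A n"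
      unfolding A_def \<phi>_def by (rule gauss_pair.mehler_expansion[OF ZW b b]) (use r2[of n] in auto)
    then show ?thesis by (simp add: h_def power2_eq_square)
  qed
  have A_le_I: "A n \<le> I" for n
  proof -
    have same_law: "integrable gauss3 (\<lambda>x. (\<phi> (V x))\<^sup>2)" "(\<integral>x. (\<phi> (V x))\<^sup>2 \<partial>gauss3) = I"
      if "distr gauss3 borel V = gauss" "V \<in> borel_measurable gauss3" for V
    proof -
      have "integrable (distr gauss3 borel V) (\<lambda>x. (\<phi> x)\<^sup>2)"
        unfolding that(1) \<phi>_def by (rule int)
      then show "integrable gauss3 (\<lambda>x. (\<phi> (V x))\<^sup>2)"
        by (subst (asm) integrable_distr_eq) (use that(2) in auto)
      have "I = (\<integral>x. (\<phi> x)\<^sup>2 \<partial>distr gauss3 borel V)" by (simp add: that(1) I_def)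
      then show "(\<integral>x. (\<phi> (V x))\<^sup>2 \<partial>gauss3) = I"
        using that(2) by (subst (asm) integral_distr) auto
    qed
    note Zn = same_law[OF gauss_pair.distr_Z[OF ZW[of n]]]
    note Wn = same_law[OF gauss_pair.distr_Z[OF gauss_pair.gauss_pair_swap[OF ZW[of n]]]]
    have "A n \<le> (\<integral>x. ((\<phi> (Z n x))\<^sup>2 + (\<phi> (W n x))\<^sup>2) / 2 \<partial>gauss3)"
      unfolding A_def
    proof (rule integral_mono[OF A_int])
      show "integrable gauss3 (\<lambda>x. ((\<phi> (Z n x))\<^sup>2 + (\<phi> (W n x))\<^sup>2) / 2)"
        using Zn(1) Wn(1) by simp
      show "\<phi> (Z n x) * \<phi> (W n x) \<le> ((\<phi> (Z n x))\<^sup>2 + (\<phi> (W n x))\<^sup>2) / 2" for x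
        using sum_squares_bound[of "\<phi> (Z n x)" "\<phi> (W n x)"] by simp
    qed
    also have "\<dots> = I" using Zn Wn by simp
    finally show ?thesis .
  qed
  have partial_le: "(\<Sum>k<K. h k) \<le> I" for K
  proof (rule LIMSEQ_le_const2)
    have "(\<lambda>n. \<Sum>k<K. h k * (r n)\<^sup>2 ^ k) \<longlonglongrightarrow> (\<Sum>k<K. h k * 1\<^sup>2 ^ k)"
      by (intro tendsto_intros r_lim)
    then show "(\<lambda>n. \<Sum>k<K. h k * (r n)\<^sup>2 ^ k) \<longlonglongrightarrow> (\<Sum>k<K. h k)" by simp
    have "(\<Sum>k<K. h k * (r n)\<^sup>2 ^ k) \<le> A n" for n
      using sum_le_suminf[OF sums_summable[OF A_sums[of n]], of "{..<K}"] h_nonneg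
        sums_unique[OF A_sums[of n]] by simp
    then show "\<exists>N. \<forall>n\<ge>N. (\<Sum>k<K. h k * (r n)\<^sup>2 ^ k) \<le> I"
      using A_le_I order_trans by blast
  qed
  have h_summable: "summable h"
    by (rule summableI_nonneg_bounded[OF h_nonneg partial_le])
  have H_le: "suminf h \<le> I"
    by (rule suminf_le_const[OF h_summable partial_le])
  have A_le_H: "A n \<le> suminf h" for n
  proof (rule sums_le[OF _ A_sums summable_sums[OF h_summable]])
    show "h k * (r n)\<^sup>2 ^ k \<le> h k" for k
      using h_nonneg[of k] r[of n] by (intro mult_left_le power_le_one) auto
  qed

  define P where "P n u = (\<integral>v. \<phi> (r n * u + s n * v) \<partial>gauss)" for n u
  obtain C where C: "\<And>r s u v. r\<^sup>2 + s\<^sup>2 = 1 \<Longrightarrow>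
    \<bar>\<phi> (r * u + s * v)\<bar> \<le> C * exp (3 * u\<^sup>2 / 8) * exp (3 / 4 * v\<^sup>2 / 2)"
    using subgaussian_bound_smoothed[OF b] unfolding \<phi>_def by blast
  have maj: "integrable gauss (\<lambda>v. C * exp (3 * u\<^sup>2 / 8) * exp (3 / 4 * v\<^sup>2 / 2))" for u
    by (intro Bochner_Integration.integrable_mult_right integrable_gauss_exp_quadratic) simp
  have P_lim: "(\<lambda>n. P n u) \<longlonglongrightarrow> \<phi> u" for u
  proof -
    have "(\<lambda>n. P n u) \<longlonglongrightarrow> (\<integral>v. \<phi> u \<partial>gauss)"
      unfolding P_def
    proof (rule integral_dominated_convergence[OF _ _ maj[of u]])
      show "AE v in gauss. (\<lambda>n. \<phi> (r n * u + s n * v)) \<longlonglongrightarrow> \<phi> u"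
      proof (rule AE_I2)
        fix v
        have "(\<lambda>n. r n * u + s n * v) \<longlonglongrightarrow> 1 * u + 0 * v"
          by (intro tendsto_intros r_lim s_lim)
        then show "(\<lambda>n. \<phi> (r n * u + s n * v)) \<longlonglongrightarrow> \<phi> u"
          using isCont_tendsto_compose[OF series_fun_continuous[OF b]] by (simp add: \<phi>_def)
      qed
      show "AE v in gauss. norm (\<phi> (r n * u + s n * v)) \<le> C * exp (3 * u\<^sup>2 / 8) * exp (3 / 4 * v\<^sup>2 / 2)" for n
        using C[OF rs] by auto
    qed measurable
    then show ?thesis using gauss.prob_space by simp
  qed
  have P_square: "(\<integral>y. \<phi> (r n * u + s n * fst y) * \<phi> (r n * u + s n * snd y) \<partial>gauss2) = (P n u)\<^sup>2" for n u
  proof -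
    have "integrable gauss (\<lambda>v. \<phi> (r n * u + s n * v))"
      by (rule Bochner_Integration.integrable_bound[OF maj[of u]])
        (auto simp only: real_norm_def intro!: AE_I2 order_trans[OF C[OF rs] abs_ge_self], measurable)
    from integral_pair_mult[OF _ _ this this] show ?thesis
      by (simp add: P_def power2_eq_square gauss.sigma_finite_measure_axioms)
  qed
  interpret pair_sigma_finite gauss gauss2 ..
  have P_int: "integrable gauss (\<lambda>u. (P n u)\<^sup>2)" "(\<integral>u. (P n u)\<^sup>2 \<partial>gauss) = A n" for n
    using integrable_fst'[OF A_int[of n]] integral_fst'[OF A_int[of n]]
    by (simp_all add: Z_def W_def P_square A_def)
  have "ennreal I = (\<integral>\<^sup>+u. ennreal ((\<phi> u)\<^sup>2) \<partial>gauss)"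
    unfolding I_def by (rule nn_integral_eq_integral[symmetric]) (use int in \<open>auto simp: \<phi>_def\<close>)
  also have "\<dots> = (\<integral>\<^sup>+u. liminf (\<lambda>n. ennreal ((P n u)\<^sup>2)) \<partial>gauss)"
    by (intro nn_integral_cong lim_imp_Liminf[symmetric] tendsto_ennrealI tendsto_power P_lim) simp
  also have "\<dots> \<le> liminf (\<lambda>n. \<integral>\<^sup>+u. ennreal ((P n u)\<^sup>2) \<partial>gauss)"
    by (rule nn_integral_liminf) (use P_int(1) in auto)
  also have "\<dots> = liminf (\<lambda>n. ennreal (A n))"
    by (simp add: nn_integral_eq_integral[OF P_int(1)] P_int(2))
  also have "\<dots> \<le> liminf (\<lambda>n. ennreal (suminf h))"
    by (intro Liminf_mono eventuallyI ennreal_leI A_le_H)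
  finally have "I \<le> suminf h"
    by (simp add: Liminf_const suminf_nonneg[OF h_summable h_nonneg])
  with H_le have "I = suminf h" by simp
  then show ?thesis
    using summable_sums[OF h_summable] by (simp add: I_def \<phi>_def h_def[abs_def])
qed

section \<open>What convergence of the variance series implies\<close>

lemma Cauchy_product_powers:
  fixes x :: "'a::comm_ring_1"
  shows "(\<Sum>i\<le>n. (d i * x ^ i) * (e (n - i) * x ^ (n - i))) = (\<Sum>i\<le>n. d i * e (n - i)) * x ^ n"
  unfolding sum_distrib_right
proof (rule sum.cong)
  fix i assume "i \<in> {..n}"
  then have "x ^ n = x ^ i * x ^ (n - i)" by (simp flip: power_add)
  then show "(d i * x ^ i) * (e (n - i) * x ^ (n - i)) = d i * e (n - i) * x ^ n" by (simp add: ac_simps)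
qed simp

lemma four_power_fact_le: "4 ^ n * (fact n)\<^sup>2 \<le> (fact (2 * n + 1) :: real)"
proof (induction n)
  case (Suc n)
  have "4 ^ Suc n * (fact (Suc n))\<^sup>2 = (2 * real n + 2)\<^sup>2 * (4 ^ n * (fact n)\<^sup>2 :: real)"
    by (simp add: power2_eq_square algebra_simps)
  also have "\<dots> \<le> (2 * real n + 2)\<^sup>2 * fact (2 * n + 1)"
    by (intro mult_left_mono Suc.IH) simp
  also have "\<dots> \<le> ((2 * real n + 3) * (2 * real n + 2)) * fact (2 * n + 1)"
    by (intro mult_right_mono) (auto simp: power2_eq_square)
  also have "\<dots> = fact (2 * Suc n + 1)"
    by (simp add: algebra_simps)
  finally show ?case .
qed simp

text \<open>Up to a linear factor, the even moments $(2n-1)!!$ of the standard normal law are no smaller than $(2n)!! = 2^n n!$.\<close>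

lemma inverse_normal_moment_le: "1 / normal_moment (2 * n) \<le> (2 * real n + 1) / (2 ^ n * fact n)"
proof -
  have "(2 ^ n * fact n) * (2 ^ n * fact n) = (4 ^ n * (fact n)\<^sup>2 :: real)"
    by (simp add: power2_eq_square flip: power_mult_distrib)
  also have "\<dots> \<le> (2 * real n + 1) * fact (2 * n)"
    using four_power_fact_le[of n] by (simp add: add.commute)
  finally show ?thesis
    by (simp only: normal_moment_even) (simp add: field_simps)
qed

text \<open>The moments turn boundedness into $|c_{2n}| \le K (2n+1) / (2^n n!)$, and the linear factor is absorbed by the
geometric factor $\eta^n$; what remains is the series of $e^{\eta R^2/2}$.\<close>

lemma square_coeffs_growth:
  fixes c :: "nat \<Rightarrow> real"
  assumes bounded: "\<And>n. \<bar>c n * normal_moment n\<bar> \<le> K"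
    and odd: "\<And>n. odd n \<Longrightarrow> c n = 0" and \<eta>: "1 < \<eta>"
  obtains D where "0 \<le> D" and "\<And>R. 0 \<le> R \<Longrightarrow> summable (\<lambda>n. \<bar>c n\<bar> * R ^ n)"
    and "\<And>R. 0 \<le> R \<Longrightarrow> (\<Sum>n. \<bar>c n\<bar> * R ^ n) \<le> D * exp (\<eta> * R\<^sup>2 / 2)"
proof -
  define L where "L = 2 / (\<eta> - 1) + 1"
  have K0: "0 \<le> K" using bounded[of 0] by simp
  have L0: "0 \<le> L" using \<eta> by (simp add: L_def)
  have lin: "2 * real n + 1 \<le> L * \<eta> ^ n" for n
  proof -
    have "1 + real n * (\<eta> - 1) \<le> \<eta> ^ n"
      using Bernoulli_inequality[of "\<eta> - 1" n] \<eta> by simp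
    then have "2 / (\<eta> - 1) * (real n * (\<eta> - 1)) \<le> 2 / (\<eta> - 1) * \<eta> ^ n"
      using \<eta> by (intro mult_left_mono) auto
    moreover have "2 / (\<eta> - 1) * (real n * (\<eta> - 1)) = 2 * real n" using \<eta> by simp
    moreover have "1 \<le> \<eta> ^ n" using \<eta> by simp
    ultimately show ?thesis by (simp add: L_def distrib_right)
  qed
  have c_le: "\<bar>c (2 * n)\<bar> * R ^ (2 * n) \<le> K * L * ((\<eta> * R\<^sup>2 / 2) ^ n / fact n)" if "0 \<le> R" for n R
  proof -
    have pos: "0 < normal_moment (2 * n)" by (simp add: normal_moment_even)
    have "\<bar>c (2 * n)\<bar> * normal_moment (2 * n) \<le> K"
      using bounded[of "2 * n"] pos by (simp add: abs_mult)
    then have "\<bar>c (2 * n)\<bar> \<le> K * (1 / normal_moment (2 * n))"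
      using pos by (simp add: field_simps)
    also have "\<dots> \<le> K * ((2 * real n + 1) / (2 ^ n * fact n))"
      by (intro mult_left_mono inverse_normal_moment_le K0)
    also have "\<dots> \<le> K * (L * \<eta> ^ n / (2 ^ n * fact n))"
      by (intro mult_left_mono divide_right_mono lin K0) simp
    finally have "\<bar>c (2 * n)\<bar> * R ^ (2 * n) \<le> K * (L * \<eta> ^ n / (2 ^ n * fact n)) * R ^ (2 * n)"
      using that by (intro mult_right_mono) auto
    then show ?thesis by (simp add: power_mult power_mult_distrib power_divide mult.assoc)
  qed
  have exp_sums: "(\<lambda>n. K * L * ((\<eta> * R\<^sup>2 / 2) ^ n / fact n)) sums (K * L * exp (\<eta> * R\<^sup>2 / 2))" for R
    by (intro sums_mult exp_sums_divide_fact)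
  have even_summable: "summable (\<lambda>n. \<bar>c (2 * n)\<bar> * R ^ (2 * n))" if "0 \<le> R" for R
    by (rule summable_comparison_test'[OF sums_summable[OF exp_sums]]) (use c_le[OF that] that in auto)
  have reindex: "(\<lambda>n. \<bar>c (2 * n)\<bar> * R ^ (2 * n)) sums S \<longleftrightarrow> (\<lambda>n. \<bar>c n\<bar> * R ^ n) sums S" for R S
  proof -
    have "n \<notin> range (\<lambda>n. 2 * n) \<Longrightarrow> \<bar>c n\<bar> * R ^ n = 0" for n
      using odd[of n] by (auto elim: evenE)
    then show ?thesis
      using sums_mono_reindex[of "\<lambda>n. 2 * n" "\<lambda>n. \<bar>c n\<bar> * R ^ n"] by (auto simp: strict_mono_def)
  qed
  show thesis
  proof (rule that)
    show "0 \<le> K * L" using K0 L0 by simp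
    fix R :: real assume R: "0 \<le> R"
    have s: "(\<lambda>n. \<bar>c n\<bar> * R ^ n) sums (\<Sum>n. \<bar>c (2 * n)\<bar> * R ^ (2 * n))"
      using summable_sums[OF even_summable[OF R]] reindex by blast
    then show "summable (\<lambda>n. \<bar>c n\<bar> * R ^ n)" by (rule sums_summable)
    show "(\<Sum>n. \<bar>c n\<bar> * R ^ n) \<le> K * L * exp (\<eta> * R\<^sup>2 / 2)"
      unfolding sums_unique[OF s, symmetric]
      by (rule sums_le[OF c_le[OF R] summable_sums[OF even_summable[OF R]] exp_sums])
  qed
qed

text \<open>The coefficients of the squared series may involve cancellation among the products $b_i b_{n-i}$, so nothing can be read off
coefficientwise. Instead the square root is taken of the complex function: $|\Phi(z)|^2$ is controlled on
all of the complex plane, and Cauchy's inequality recovers the individual $b_p$.\<close>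

lemma subgaussian_if_square_moments_bounded:
  fixes b c :: "nat \<Rightarrow> real"
  assumes conv: "\<And>x. summable (\<lambda>n. b n * x ^ n)"
    and c: "\<And>n. c n = (\<Sum>i\<le>n. b i * b (n - i))"
    and bounded: "\<And>n. \<bar>c n * normal_moment n\<bar> \<le> K"
    and odd: "\<And>n. odd n \<Longrightarrow> c n = 0"
  shows "subgaussian_series b"
  unfolding subgaussian_series_def
proof (intro allI impI)
  fix \<theta> :: real assume \<theta>: "1 < \<theta>"
  define \<eta> where "\<eta> = sqrt \<theta>"
  define q where "q = sqrt \<eta>"
  have \<eta>: "1 < \<eta>" "\<eta> * \<eta> = \<theta>" using \<theta> by (auto simp: \<eta>_def)
  have q: "1 < q" "q\<^sup>2 = \<eta>" using \<eta>(1) by (auto simp: q_def)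
  obtain D where D: "0 \<le> D" "\<And>R. 0 \<le> R \<Longrightarrow> summable (\<lambda>n. \<bar>c n\<bar> * R ^ n)"
    "\<And>R. 0 \<le> R \<Longrightarrow> (\<Sum>n. \<bar>c n\<bar> * R ^ n) \<le> D * exp (\<eta> * R\<^sup>2 / 2)"
    using square_coeffs_growth[OF bounded odd \<eta>(1)] by blast
  define \<Phi> where "\<Phi> z = (\<Sum>n. complex_of_real (b n) * z ^ n)" for z
  note abs = powser_conv_everywhere_complex[OF conv]
  have \<Phi>_sums: "(\<lambda>n. complex_of_real (b n) * z ^ n) sums \<Phi> z" for z
    unfolding \<Phi>_def by (rule summable_sums[OF summable_norm_cancel[OF abs]])
  have \<Phi>_bound: "norm (\<Phi> z) \<le> sqrt D * exp (\<eta> * (norm z)\<^sup>2 / 4)" for z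
  proof -
    have "(\<lambda>n. \<Sum>i\<le>n. (complex_of_real (b i) * z ^ i) * (complex_of_real (b (n - i)) * z ^ (n - i))) sums (\<Phi> z * \<Phi> z)"
      using Cauchy_product_sums[OF abs abs, of z z] by (simp add: \<Phi>_def)
    also have "(\<lambda>n. \<Sum>i\<le>n. (complex_of_real (b i) * z ^ i) * (complex_of_real (b (n - i)) * z ^ (n - i)))
        = (\<lambda>n. complex_of_real (c n) * z ^ n)"
      using Cauchy_product_powers[of "\<lambda>i. complex_of_real (b i)" z "\<lambda>i. complex_of_real (b i)"]
      by (simp add: c)
    finally have sq: "(\<lambda>n. complex_of_real (c n) * z ^ n) sums (\<Phi> z * \<Phi> z)" .
    have "(norm (\<Phi> z))\<^sup>2 = norm (\<Sum>n. complex_of_real (c n) * z ^ n)"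
      unfolding sums_unique[OF sq, symmetric] by (simp add: norm_mult power2_eq_square)
    also have "\<dots> \<le> (\<Sum>n. norm (complex_of_real (c n) * z ^ n))"
      by (rule summable_norm) (use D(2)[of "norm z"] in \<open>simp add: norm_mult norm_power\<close>)
    also have "\<dots> = (\<Sum>n. \<bar>c n\<bar> * norm z ^ n)"
      by (simp add: norm_mult norm_power)
    also have "\<dots> \<le> D * exp (\<eta> * (norm z)\<^sup>2 / 2)"
      by (rule D(3)) simp
    also have "\<dots> = (sqrt D * exp (\<eta> * (norm z)\<^sup>2 / 4))\<^sup>2"
      using D(1) by (simp add: power_mult_distrib power2_eq_square[of "exp _"] mult_exp_exp)
    finally show ?thesis
      by (rule power2_le_imp_le) (use D(1) in simp)
  qed
  have term_le: "\<bar>b p\<bar> * \<bar>x\<bar> ^ p \<le> sqrt D * exp (\<theta> * x\<^sup>2 / 4) * (1 / q) ^ p" for p x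
  proof (cases "x = 0")
    case True
    have "\<bar>b 0\<bar> \<le> sqrt D"
      using \<Phi>_bound[of 0] by (simp add: \<Phi>_def)
    then show ?thesis using True D(1) q(1) by (cases p) auto
  next
    case False
    \<comment> \<open>Coefficients are estimated on a circle larger by the factor $q$, so that a geometric series remains; the growth
    rate increases from $\eta$ to $\eta q^2 = \theta$.\<close>
    define R where "R = q * \<bar>x\<bar>"
    have R: "0 < R" using False q(1) by (simp add: R_def)
    have "norm (complex_of_real (b p)) \<le> sqrt D * exp (\<eta> * R\<^sup>2 / 4) / R ^ p"
      by (rule powser_coeff_bound[OF \<Phi>_sums R]) (use \<Phi>_bound in auto)
    also have "\<eta> * R\<^sup>2 = \<theta> * x\<^sup>2"
      by (simp add: R_def power_mult_distrib q(2) flip: \<eta>(2))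
    finally have "\<bar>b p\<bar> * \<bar>x\<bar> ^ p \<le> sqrt D * exp (\<theta> * x\<^sup>2 / 4) / R ^ p * \<bar>x\<bar> ^ p"
      by (intro mult_right_mono) auto
    then show ?thesis
      using False by (simp add: R_def power_mult_distrib power_one_over divide_simps)
  qed
  have geom: "(\<lambda>p. sqrt D * exp (\<theta> * x\<^sup>2 / 4) * (1 / q) ^ p) sums (sqrt D * exp (\<theta> * x\<^sup>2 / 4) * (1 / (1 - 1 / q)))" for x
    by (intro sums_mult geometric_sums) (use q(1) in auto)
  show "\<exists>C. \<forall>x. summable (\<lambda>p. \<bar>b p\<bar> * \<bar>x\<bar> ^ p) \<and> (\<Sum>p. \<bar>b p\<bar> * \<bar>x\<bar> ^ p) \<le> C * exp (\<theta> * x\<^sup>2 / 4)"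
  proof (intro exI allI conjI)
    fix x
    show smbl: "summable (\<lambda>p. \<bar>b p\<bar> * \<bar>x\<bar> ^ p)"
      by (rule summable_comparison_test'[OF sums_summable[OF geom[of x]]]) (use term_le[of _ x] in auto)
    show "(\<Sum>p. \<bar>b p\<bar> * \<bar>x\<bar> ^ p) \<le> sqrt D * (1 / (1 - 1 / q)) * exp (\<theta> * x\<^sup>2 / 4)"
      using sums_le[OF term_le summable_sums[OF smbl] geom] by (simp add: ac_simps)
  qed
qed

text \<open>Summation by parts, carried out as the Cauchy product with the geometric series:
$s / (1 - t) = \sum_n A_n t^n$ with $A_n$ the partial sums of $a$.\<close>

lemma abel_sum_bounded:
  fixes a :: "nat \<Rightarrow> real"
  assumes partial: "\<And>n. \<bar>\<Sum>i<n. a i\<bar> \<le> K" and t: "0 \<le> t" "t < 1"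
    and s: "(\<lambda>n. a n * t ^ n) sums s"
  shows "\<bar>s\<bar> \<le> K"
proof -
  have geom: "(\<lambda>n. K * t ^ n) sums (K * (1 / (1 - t)))"
    by (intro sums_mult geometric_sums) (use t in auto)
  have "\<bar>a n\<bar> \<le> 2 * K" for n
    using partial[of n] partial[of "Suc n"] by (simp add: abs_if split: if_splits)
  then have "norm (norm (a n * t ^ n)) \<le> 2 * (K * t ^ n)" for n
    using t(1) mult_right_mono[of "\<bar>a n\<bar>" "2 * K" "t ^ n"] by (simp add: abs_mult)
  then have abs_a: "summable (\<lambda>n. norm (a n * t ^ n))"
    by (intro summable_comparison_test'[OF summable_mult[OF sums_summable[OF geom]]])
  have abs_t: "summable (\<lambda>n. norm (t ^ n))"
    using t by (simp add: summable_geometric)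
  have "(\<lambda>n. \<Sum>i\<le>n. (a i * t ^ i) * t ^ (n - i)) sums ((\<Sum>n. a n * t ^ n) * (\<Sum>n. t ^ n))"
    by (rule Cauchy_product_sums[OF abs_a abs_t])
  also have "(\<Sum>n. a n * t ^ n) * (\<Sum>n. t ^ n) = s * (1 / (1 - t))"
    using s t by (simp add: sums_iff suminf_geometric)
  also have "(\<lambda>n. \<Sum>i\<le>n. (a i * t ^ i) * t ^ (n - i)) = (\<lambda>n. (\<Sum>i<Suc n. a i) * t ^ n)"
    using Cauchy_product_powers[of a t "\<lambda>_. 1"]
    by (simp add: lessThan_Suc_atMost del: sum.lessThan_Suc)
  finally have S: "(\<lambda>n. (\<Sum>i<Suc n. a i) * t ^ n) sums (s * (1 / (1 - t)))" .
  have le: "\<bar>(\<Sum>i<Suc n. a i) * t ^ n\<bar> \<le> K * t ^ n" for n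
    unfolding abs_mult using partial[of "Suc n"] t(1) by (intro mult_mono) auto
  have "s * (1 / (1 - t)) \<le> K * (1 / (1 - t))"
    by (rule sums_le[OF _ S geom]) (use le abs_le_D1 in blast)
  moreover have "- (s * (1 / (1 - t))) \<le> K * (1 / (1 - t))"
    by (rule sums_le[OF _ sums_minus[OF S] geom]) (use le abs_le_D2 in blast)
  ultimately show ?thesis
    using t by (simp add: divide_le_cancel divide_minus_left[symmetric] del: divide_minus_left)
qed

text \<open>For $t < 1$ the contracted function $\varphi(tx)$ is safely square integrable, and its second moment is the power
series $\sum_n c_n E[Z^n]\, t^n$, which Abel summation bounds uniformly in $t$. Fatou's lemma passes to $t = 1$.\<close>

lemma integrable_square_if_moment_series_converges:
  assumes b: "subgaussian_series b"
    and c: "\<And>n. c n = (\<Sum>i\<le>n. b i * b (n - i))"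
    and conv: "summable (\<lambda>n. c n * normal_moment n)"
  shows "integrable gauss (\<lambda>x. (series_fun b x)\<^sup>2)"
proof -
  note [measurable] = series_fun_measurable[OF b]
  define \<phi> where "\<phi> = series_fun b"
  have [measurable]: "\<phi> \<in> borel_measurable borel" unfolding \<phi>_def by measurable
  have "Bseq (\<lambda>n. \<Sum>i<n. c i * normal_moment i)"
    using summable_LIMSEQ[OF conv] by (intro convergent_imp_Bseq convergentI)
  then obtain K where K: "\<And>n. \<bar>\<Sum>i<n. c i * normal_moment i\<bar> \<le> K"
    unfolding Bseq_def by auto
  have contracted: "integrable gauss (\<lambda>x. (\<phi> (t * x))\<^sup>2)" "(\<integral>x. (\<phi> (t * x))\<^sup>2 \<partial>gauss) \<le> K"
    if t: "0 < t" "t < 1" for t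
  proof -
    \<comment> \<open>The growth rate $1/t$ is chosen so that $\varphi(tx)^2$ is bounded by a multiple of $e^{t x^2/2}$.\<close>
    have "1 < 1 / t" using t by simp
    then obtain C where C: "\<And>x. (\<Sum>p. \<bar>b p\<bar> * \<bar>x\<bar> ^ p) \<le> C * exp (1 / t * x\<^sup>2 / 4)"
      using b unfolding subgaussian_series_def by metis
    have abs: "summable (\<lambda>p. norm (b p * x ^ p))" for x
      using subgaussian_summable[OF b, of x] by (simp add: abs_mult power_abs)
    have sums: "(\<lambda>n. c n * (t * x) ^ n) sums ((\<phi> (t * x))\<^sup>2)" for x
      using Cauchy_product_sums[OF abs abs, of "t * x" "t * x"]
      by (simp only: Cauchy_product_powers c \<phi>_def series_fun_def power2_eq_square)
    have bound: "norm (\<Sum>n<N. c n * (t * x) ^ n) \<le> C\<^sup>2 * exp (t * x\<^sup>2 / 2)" for N x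
    proof -
      let ?y = "\<bar>t * x\<bar>"
      have abs': "summable (\<lambda>p. norm (\<bar>b p\<bar> * ?y ^ p))"
        using subgaussian_summable[OF b, of "t * x"] by simp
      have maj: "(\<lambda>n. (\<Sum>i\<le>n. \<bar>b i\<bar> * \<bar>b (n - i)\<bar>) * ?y ^ n) sums ((\<Sum>p. \<bar>b p\<bar> * ?y ^ p)\<^sup>2)"
        using Cauchy_product_sums[OF abs' abs'] Cauchy_product_powers[of "\<lambda>i. \<bar>b i\<bar>" ?y "\<lambda>i. \<bar>b i\<bar>"]
        by (simp only: power2_eq_square)
      have "norm (\<Sum>n<N. c n * (t * x) ^ n) \<le> (\<Sum>n<N. (\<Sum>i\<le>n. \<bar>b i\<bar> * \<bar>b (n - i)\<bar>) * ?y ^ n)"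
      proof (rule order_trans[OF norm_sum], rule sum_mono)
        fix n
        have "\<bar>c n\<bar> \<le> (\<Sum>i\<le>n. \<bar>b i\<bar> * \<bar>b (n - i)\<bar>)"
          unfolding c abs_mult[symmetric] by (rule sum_abs)
        then have "\<bar>c n\<bar> * ?y ^ n \<le> (\<Sum>i\<le>n. \<bar>b i\<bar> * \<bar>b (n - i)\<bar>) * ?y ^ n"
          by (intro mult_right_mono) auto
        then show "norm (c n * (t * x) ^ n) \<le> (\<Sum>i\<le>n. \<bar>b i\<bar> * \<bar>b (n - i)\<bar>) * ?y ^ n"
          unfolding real_norm_def abs_mult[of "c n"] power_abs .
      qed
      also have "\<dots> \<le> (\<Sum>n. (\<Sum>i\<le>n. \<bar>b i\<bar> * \<bar>b (n - i)\<bar>) * ?y ^ n)"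
        by (rule sum_le_suminf[OF sums_summable[OF maj]]) (auto intro!: mult_nonneg_nonneg sum_nonneg)
      also have "\<dots> = (\<Sum>p. \<bar>b p\<bar> * ?y ^ p)\<^sup>2"
        by (rule sums_unique[OF maj, symmetric])
      also have "\<dots> \<le> (C * exp (1 / t * (t * x)\<^sup>2 / 4))\<^sup>2"
        by (intro power_mono C suminf_nonneg subgaussian_summable[OF b]) auto
      also have "\<dots> = C\<^sup>2 * exp (t * x\<^sup>2 / 2)"
        using t(1) by (simp add: power_mult_distrib power2_eq_square[of "exp _"] mult_exp_exp)
          (simp add: power2_eq_square)
      finally show ?thesis .
    qed
    have maj: "integrable gauss (\<lambda>x. C\<^sup>2 * exp (t * x\<^sup>2 / 2))"
      by (intro Bochner_Integration.integrable_mult_right integrable_gauss_exp_quadratic t)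
    note I = integral_sums_dominated[of "\<lambda>n x. c n * (t * x) ^ n" gauss, OF _ sums maj bound]
    show "integrable gauss (\<lambda>x. (\<phi> (t * x))\<^sup>2)" by (rule I(1)) measurable
    have "(\<lambda>n. \<integral>x. c n * (t * x) ^ n \<partial>gauss) sums (\<integral>x. (\<phi> (t * x))\<^sup>2 \<partial>gauss)"
      by (rule I(3)) measurable
    then have "(\<lambda>n. (c n * normal_moment n) * t ^ n) sums (\<integral>x. (\<phi> (t * x))\<^sup>2 \<partial>gauss)"
      by (simp add: power_mult_distrib normal_moment_def ac_simps)
    from abel_sum_bounded[OF K _ t(2) this] t(1)
    show "(\<integral>x. (\<phi> (t * x))\<^sup>2 \<partial>gauss) \<le> K" by simp
  qed
  define t :: "nat \<Rightarrow> real" where "t n = real (Suc n) / real (Suc (Suc n))" for n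
  have t: "0 < t n" "t n < 1" for n by (auto simp: t_def)
  have t_lim: "t \<longlonglongrightarrow> 1"
    unfolding t_def using LIMSEQ_Suc[OF LIMSEQ_n_over_Suc_n] by simp
  show ?thesis
  proof (rule integrableI_nonneg)
    show "(\<lambda>x. (series_fun b x)\<^sup>2) \<in> borel_measurable gauss" by measurable
    have "(\<integral>\<^sup>+x. ennreal ((\<phi> x)\<^sup>2) \<partial>gauss) = (\<integral>\<^sup>+x. liminf (\<lambda>n. ennreal ((\<phi> (t n * x))\<^sup>2)) \<partial>gauss)"
    proof (intro nn_integral_cong lim_imp_Liminf[symmetric] tendsto_ennrealI tendsto_power)
      fix x
      have "(\<lambda>n. t n * x) \<longlonglongrightarrow> 1 * x" by (intro tendsto_intros t_lim)
      then show "(\<lambda>n. \<phi> (t n * x)) \<longlonglongrightarrow> \<phi> x"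
        using isCont_tendsto_compose[OF series_fun_continuous[OF b]] by (simp add: \<phi>_def)
    qed simp
    also have "\<dots> \<le> liminf (\<lambda>n. \<integral>\<^sup>+x. ennreal ((\<phi> (t n * x))\<^sup>2) \<partial>gauss)"
      by (rule nn_integral_liminf) measurable
    also have "\<dots> \<le> liminf (\<lambda>n. ennreal K)"
      using contracted[OF t] by (intro Liminf_mono eventuallyI) (simp add: nn_integral_eq_integral ennreal_leI)
    also have "\<dots> < \<infinity>" by (simp add: Liminf_const)
    finally show "(\<integral>\<^sup>+x. ennreal ((series_fun b x)\<^sup>2) \<partial>gauss) < \<infinity>" by (simp add: \<phi>_def)
  qed simp
qed

section \<open>Nondegenerate multivariate normal vectors\<close>

lemma symmetric_matrix_inner:
  fixes S :: "real ^ 'd ^ 'd"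
  assumes "transpose S = S"
  shows "(S *v x) \<bullet> y = x \<bullet> (S *v y)"
  by (metis assms dot_lmul_matrix transpose_matrix_vector)

lemma matrix_inv_left_right:
  fixes S :: "real ^ 'd ^ 'd"
  assumes "invertible S"
  shows "S ** matrix_inv S = mat 1" and "matrix_inv S ** S = mat 1"
  using someI_ex[OF assms[unfolded invertible_def]] by (simp_all add: matrix_inv_def)

lemma axis_quadratic_form:
  fixes S :: "real ^ 'd ^ 'd"
  assumes sym: "transpose S = S"
  shows "(\<alpha> *\<^sub>R axis i 1 + \<beta> *\<^sub>R axis j 1) \<bullet> (S *v (\<alpha> *\<^sub>R axis i 1 + \<beta> *\<^sub>R axis j 1))
       = \<alpha>\<^sup>2 * S $ i $ i + 2 * \<alpha> * \<beta> * S $ i $ j + \<beta>\<^sup>2 * S $ j $ j"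
proof -
  have entry: "axis k 1 \<bullet> (S *v axis l 1) = S $ k $ l" for k l
    by (simp add: matrix_vector_mult_basis column_def inner_axis' )
  have "S $ j $ i = S $ i $ j"
    using sym by (metis transpose_def vec_lambda_beta)
  then show ?thesis
    by (simp add: inner_add_left inner_add_right matrix_vector_right_distrib
        matrix_vector_mult_scaleR entry power2_eq_square algebra_simps)
qed

text \<open>If $v \cdot Sv = 0$, then moving from $v$ a small distance against $w = Sv \neq 0$ would make the form negative.\<close>

lemma invertible_covariance_positive_definite:
  fixes S :: "real ^ 'd ^ 'd"
  assumes cov: "is_covariance_matrix S" and inv: "invertible S" and "v \<noteq> 0"
  shows "0 < v \<bullet> (S *v v)"
proof (rule ccontr)
  assume "\<not> 0 < v \<bullet> (S *v v)"
  moreover have psd: "0 \<le> x \<bullet> (S *v x)" for x using cov by (simp add: is_covariance_matrix_def)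
  ultimately have zero: "v \<bullet> (S *v v) = 0" by (simp add: order_antisym)
  have sym: "transpose S = S" using cov by (simp add: is_covariance_matrix_def)
  define w q where "w = S *v v" and "q = w \<bullet> (S *v w)"
  \<comment> \<open>With $q + 1$ in place of $q$ this nearly minimises $-2\epsilon |w|^2 + \epsilon^2 q$, and the denominator is positive.\<close>
  define \<epsilon> where "\<epsilon> = (w \<bullet> w) / (q + 1)"
  have q: "0 \<le> q" unfolding q_def by (rule psd)
  have w: "w \<noteq> 0"
  proof
    assume "w = 0"
    then have "matrix_inv S *v (S *v v) = 0" by (simp add: w_def)
    then show False
      using \<open>v \<noteq> 0\<close> matrix_inv_left_right(2)[OF inv] by (simp add: matrix_vector_mul_assoc)
  qed
  then have ww: "0 < w \<bullet> w" by simp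
  have "(v - \<epsilon> *\<^sub>R w) \<bullet> (S *v (v - \<epsilon> *\<^sub>R w)) = v \<bullet> (S *v v) - 2 * \<epsilon> * (w \<bullet> w) + \<epsilon>\<^sup>2 * q"
    using symmetric_matrix_inner[OF sym, of v w]
    by (simp add: w_def[symmetric] q_def inner_diff_left inner_diff_right matrix_vector_mult_diff_distrib
        matrix_vector_mult_scaleR inner_commute power2_eq_square algebra_simps)
  then have "2 * \<epsilon> * (w \<bullet> w) \<le> \<epsilon>\<^sup>2 * q" using psd[of "v - \<epsilon> *\<^sub>R w"] zero by simp
  also have "\<epsilon>\<^sup>2 * q \<le> \<epsilon>\<^sup>2 * (q + 1)" by (simp add: mult_left_mono)
  also have "\<dots> = \<epsilon> * (w \<bullet> w)" using q by (simp add: \<epsilon>_def power2_eq_square)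
  finally have "\<epsilon> * (w \<bullet> w) \<le> 0" by simp
  moreover have "0 < \<epsilon> * (w \<bullet> w)" using ww q by (simp add: \<epsilon>_def)
  ultimately show False by simp
qed

lemma invertible_covariance_entries:
  fixes S :: "real ^ 'd ^ 'd"
  assumes cov: "is_covariance_matrix S" and inv: "invertible S"
  shows "0 < S $ i $ i" and "i \<noteq> j \<Longrightarrow> (S $ i $ j)\<^sup>2 < S $ i $ i * S $ j $ j"
proof -
  have sym: "transpose S = S" using cov by (simp add: is_covariance_matrix_def)
  show pos: "0 < S $ i $ i" for i
    using invertible_covariance_positive_definite[OF cov inv, of "axis i 1"]
      axis_quadratic_form[OF sym, of 1 i 0 i] by simp
  assume "i \<noteq> j"
  define v :: "real ^ 'd" where "v = (S $ j $ j) *\<^sub>R axis i 1 + (- S $ i $ j) *\<^sub>R axis j 1"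
  have "v $ i = S $ j $ j" using \<open>i \<noteq> j\<close> by (simp add: v_def axis_def)
  then have "v \<noteq> 0" using pos[of j] by auto
  then have "0 < v \<bullet> (S *v v)" by (rule invertible_covariance_positive_definite[OF cov inv])
  also have "v \<bullet> (S *v v) = S $ j $ j * (S $ i $ i * S $ j $ j - (S $ i $ j)\<^sup>2)"
    unfolding v_def axis_quadratic_form[OF sym] by (simp add: power2_eq_square algebra_simps)
  finally show "(S $ i $ j)\<^sup>2 < S $ i $ i * S $ j $ j"
    using pos[of j] by (simp add: zero_less_mult_iff)
qed

text \<open>Completing the square translates the density by $St$. The shifted density still has integral $1$,
which leaves the factor produced by the square.\<close>

lemma mvn_mgf:
  fixes S :: "real ^ 'd ^ 'd"
  assumes M: "prob_space M" and sym: "transpose S = S" and inv: "invertible S"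
    and X: "distributed M lborel X (\<lambda>x. ennreal (mvn_density 0 S x))"
  shows "(\<integral>\<^sup>+\<omega>. ennreal (exp (t \<bullet> X \<omega>)) \<partial>M) = ennreal (exp (t \<bullet> (S *v t) / 2))"
proof -
  interpret prob_space M by fact
  define g where "g x = ennreal (mvn_density 0 S x)" for x
  have g [measurable]: "g \<in> borel_measurable borel"
    using distributed_borel_measurable[OF X] by (simp add: g_def[abs_def])
  define m where "m = S *v t"
  have inv_m: "matrix_inv S *v m = t"
    using matrix_inv_left_right(2)[OF inv] by (simp add: m_def matrix_vector_mul_assoc)
  have m_inv: "m \<bullet> (matrix_inv S *v x) = t \<bullet> x" for x
    using matrix_inv_left_right(1)[OF inv]
    by (simp add: m_def symmetric_matrix_inner[OF sym] matrix_vector_mul_assoc)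
  have shift: "g x * ennreal (exp (t \<bullet> x)) = g (- m + x) * ennreal (exp (t \<bullet> m / 2))" for x
  proof -
    have "(- m + x) \<bullet> (matrix_inv S *v (- m + x)) = x \<bullet> (matrix_inv S *v x) - 2 * (t \<bullet> x) + t \<bullet> m"
      using m_inv[of x] inv_m
      by (simp add: inner_diff_left inner_diff_right matrix_vector_mult_diff_distrib inner_commute)
    then have "exp (- (x \<bullet> (matrix_inv S *v x)) / 2) * exp (t \<bullet> x)
        = exp (- ((- m + x) \<bullet> (matrix_inv S *v (- m + x))) / 2) * exp (t \<bullet> m / 2)"
      unfolding mult_exp_exp by (intro arg_cong[of _ _ exp]) (simp add: field_simps)
    then have "mvn_density 0 S x * exp (t \<bullet> x) = mvn_density 0 S (- m + x) * exp (t \<bullet> m / 2)"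
      by (simp add: mvn_density_def)
    then show ?thesis unfolding g_def by (simp flip: ennreal_mult'')
  qed
  have g_shift: "(\<integral>\<^sup>+x. g (- m + x) \<partial>lborel) = (\<integral>\<^sup>+x. g x \<partial>lborel)"
    by (subst (2) lborel_distr_plus[of "- m", symmetric]) (simp add: nn_integral_distr)
  have total: "(\<integral>\<^sup>+x. g x \<partial>lborel) = 1"
    using distributed_nn_integral[OF X, of "\<lambda>_. 1"] emeasure_space_1 by (simp add: g_def)
  have "(\<integral>\<^sup>+\<omega>. ennreal (exp (t \<bullet> X \<omega>)) \<partial>M) = (\<integral>\<^sup>+x. g x * ennreal (exp (t \<bullet> x)) \<partial>lborel)"
    unfolding g_def by (rule distributed_nn_integral[OF X, symmetric]) measurable
  also have "\<dots> = (\<integral>\<^sup>+x. g (- m + x) \<partial>lborel) * ennreal (exp (t \<bullet> m / 2))"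
    unfolding shift by (rule nn_integral_multc) measurable
  also have "\<dots> = ennreal (exp (t \<bullet> m / 2))"
    unfolding g_shift total by simp
  finally show ?thesis by (simp add: m_def)
qed

lemma mvn_gauss_pair:
  fixes S :: "real ^ 'd ^ 'd"
  assumes M: "prob_space M" and cov: "is_covariance_matrix S" and inv: "invertible S"
    and X: "distributed M lborel X (\<lambda>x. ennreal (mvn_density 0 S x))"
  shows "gauss_pair M (\<lambda>\<omega>. X \<omega> $ i / sqrt (S $ i $ i)) (\<lambda>\<omega>. X \<omega> $ j / sqrt (S $ j $ j))
    (S $ i $ j / (sqrt (S $ i $ i) * sqrt (S $ j $ j)))"
proof -
  interpret prob_space M by fact
  have sym: "transpose S = S" using cov by (simp add: is_covariance_matrix_def)
  have X_meas: "X \<in> borel_measurable M" using distributed_measurable[OF X] by simp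
  have [measurable]: "(\<lambda>\<omega>. X \<omega> $ k) \<in> borel_measurable M" for k
    using borel_measurable_inner[OF X_meas borel_measurable_const, of "axis k 1"] by (simp add: inner_axis)
  note pos = invertible_covariance_entries(1)[OF cov inv]
  show ?thesis
  proof unfold_locales
    fix a b :: real
    define si sj where "si = sqrt (S $ i $ i)" and "sj = sqrt (S $ j $ j)"
    have s: "0 < si" "0 < sj" "si\<^sup>2 = S $ i $ i" "sj\<^sup>2 = S $ j $ j"
      using pos[of i] pos[of j] by (auto simp: si_def sj_def)
    define t :: "real ^ 'd" where "t = (a / si) *\<^sub>R axis i 1 + (b / sj) *\<^sub>R axis j 1"
    have "t \<bullet> x = a * (x $ i / si) + b * (x $ j / sj)" for x
      by (simp add: t_def inner_add_left inner_axis')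
    moreover have "t \<bullet> (S *v t) / 2 = (a\<^sup>2 + b\<^sup>2) / 2 + S $ i $ j / (si * sj) * a * b"
    proof -
      have "(a / si)\<^sup>2 * S $ i $ i = a\<^sup>2" "(b / sj)\<^sup>2 * S $ j $ j = b\<^sup>2"
        using s(1,2) by (simp_all add: s(3,4)[symmetric] power_divide)
      then show ?thesis unfolding t_def axis_quadratic_form[OF sym] by (simp add: field_simps)
    qed
    ultimately show "(\<integral>\<^sup>+\<omega>. ennreal (exp (a * (X \<omega> $ i / sqrt (S $ i $ i)) + b * (X \<omega> $ j / sqrt (S $ j $ j)))) \<partial>M)
      = ennreal (exp ((a\<^sup>2 + b\<^sup>2) / 2 + S $ i $ j / (sqrt (S $ i $ i) * sqrt (S $ j $ j)) * a * b))"
      using mvn_mgf[OF M sym inv X, of t] by (simp add: si_def sj_def)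
  qed measurable
qed

section \<open>The transformed covariance matrix\<close>

text \<open>The hypothesis only mentions the odd derivatives; that the even ones vanish follows because a power series
determines the derivatives of its sum.\<close>

lemma odd_series_taylor_coeffs:
  fixes f :: "real \<Rightarrow> real"
  assumes "\<And>x. (\<lambda>u. (deriv ^^ (2 * u + 1)) f 0 / fact (2 * u + 1) * x ^ (2 * u + 1)) sums f x"
  shows "even n \<Longrightarrow> (deriv ^^ n) f 0 = 0"
    and "(\<lambda>n. (deriv ^^ n) f 0 / fact n * x ^ n) sums f x"
proof -
  define e where "e n = (if odd n then (deriv ^^ n) f 0 / fact n else 0)" for n
  have "(\<lambda>n. e n * x ^ n) sums f x" for x
  proof -
    have "(\<lambda>u. (\<lambda>n. e n * x ^ n) (2 * u + 1)) sums f x"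
      using assms[of x] by (simp add: e_def)
    moreover have "n \<notin> range (\<lambda>u. 2 * u + 1) \<Longrightarrow> e n * x ^ n = 0" for n
      by (auto simp: e_def elim!: oddE)
    ultimately show ?thesis
      by (subst (asm) sums_mono_reindex) (auto simp: strict_mono_def)
  qed
  note e_sums = this
  have deriv_eq: "(deriv ^^ n) f 0 = fact n * e n" for n
    by (rule iterated_deriv_powser_at_0[OF e_sums])
  then show "(\<lambda>n. (deriv ^^ n) f 0 / fact n * x ^ n) sums f x"
    using e_sums[of x] by simp
  show "even n \<Longrightarrow> (deriv ^^ n) f 0 = 0"
    using deriv_eq[of n] by (simp add: e_def split: if_splits)
qed

text \<open>Only $p = 2u + k$ contributes, with \<open>hermite_moment (2 * u + k) k = fact (2 * u + k) / (2 ^ u * fact u)\<close>.\<close>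

lemma hermite_coeff_scaled_taylor:
  assumes b: "subgaussian_series (\<lambda>p. (deriv ^^ p) f 0 / fact p * s ^ p)" and s: "0 < s"
  shows "(\<lambda>u. (deriv ^^ (2 * u + k)) f 0 / fact u * (s\<^sup>2 * (1 / 2)) ^ u) sums
    (hermite_coeff (\<lambda>p. (deriv ^^ p) f 0 / fact p * s ^ p) k / s ^ k)"
proof -
  let ?b = "\<lambda>p. (deriv ^^ p) f 0 / fact p * s ^ p"
  have "(\<lambda>p. ?b p * hermite_moment p k) sums hermite_coeff ?b k"
    by (rule has_sum_imp_sums[OF hermite_coeff_has_sum[OF b]])
  moreover have "?b p * hermite_moment p k = 0" if "p \<notin> range (\<lambda>u. 2 * u + k)" for p
  proof (cases "p < k")
    case False
    then obtain n where n: "p = n + k" by (metis add.commute le_Suc_ex not_le_imp_less)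
    with that have "odd n" by (auto elim!: evenE)
    then show ?thesis by (simp add: n hermite_moment_def normal_moment_odd)
  qed (simp add: hermite_moment_eq_0)
  ultimately have "(\<lambda>u. ?b (2 * u + k) * hermite_moment (2 * u + k) k) sums hermite_coeff ?b k"
    by (subst sums_mono_reindex[of "\<lambda>u. 2 * u + k" "\<lambda>p. ?b p * hermite_moment p k"])
      (auto simp: strict_mono_def)
  from sums_divide[OF this, of "s ^ k"]
  have "(\<lambda>u. ?b (2 * u + k) * hermite_moment (2 * u + k) k / s ^ k) sums (hermite_coeff ?b k / s ^ k)" .
  moreover have "?b (2 * u + k) * hermite_moment (2 * u + k) k / s ^ k
    = (deriv ^^ (2 * u + k)) f 0 / fact u * (s\<^sup>2 * (1 / 2)) ^ u" for u
  proof -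
    have "hermite_moment (2 * u + k) k = fact (2 * u + k) / (2 ^ u * fact u)"
      by (simp only: hermite_moment_add normal_moment_even) simp
    moreover have "s ^ (2 * u + k) = s\<^sup>2 ^ u * s ^ k" by (simp add: power_add power_mult)
    ultimately show ?thesis
      using s by (simp add: power_mult_distrib power_divide)
  qed
  ultimately show ?thesis by simp
qed

lemma (in gauss_pair) expectation_odd_eq_0:
  fixes g :: "real \<Rightarrow> real"
  assumes [measurable]: "g \<in> borel_measurable borel" and odd: "\<And>x. g (- x) = - g x"
  shows "(\<integral>\<omega>. g (W \<omega>) \<partial>M) = 0"
proof -
  have law: "(\<integral>\<omega>. g (V \<omega>) \<partial>M) = (\<integral>x. g x \<partial>gauss)"
    if "distr M borel V = gauss" "V \<in> borel_measurable M" for V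
    using integral_distr[OF that(2), of g] that(1) by simp
  have "(\<integral>\<omega>. g (W \<omega>) \<partial>M) = (\<integral>\<omega>. g (- W \<omega>) \<partial>M)"
    unfolding law[OF gauss_pair.distr_Z[OF gauss_pair_swap] W_measurable]
    by (rule law[OF gauss_pair.distr_Z[OF gauss_pair.gauss_pair_swap[OF gauss_pair_uminus]], symmetric]) measurable
  then show ?thesis by (simp add: odd)
qed

theorem theorem2p2:
  fixes M :: "'a measure" and X Y :: "'a \<Rightarrow> real ^ 'd"
    and S :: "real ^ 'd ^ 'd" and f :: "real \<Rightarrow> real"
  assumes "prob_space M"
    and "is_covariance_matrix S" and "invertible S"
    and "distributed M lborel X (\<lambda>x. ennreal (mvn_density 0 S x))"
    and "\<And>x. (\<lambda>u. (deriv ^^ (2 * u + 1)) f 0 / fact (2 * u + 1) * x ^ (2 * u + 1)) sums f x"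
    and "\<And>\<omega>. Y \<omega> = (\<chi> i. f (X \<omega> $ i))"
    and "\<And>i j. summable (\<lambda>n. \<Sum>p=0..n. (deriv ^^ p) f 0 * (deriv ^^ (n - p)) f 0 /
                 (fact p * fact (n - p)) * (\<integral>\<omega>. (X \<omega> $ i) ^ p * (X \<omega> $ j) ^ (n - p) \<partial>M))"
  shows "\<forall>i j.
      integrable M (\<lambda>\<omega>. f (X \<omega> $ i) * f (X \<omega> $ j)) \<and>
      covariance_matrix_of M Y $ i $ j = (\<integral>\<omega>. f (X \<omega> $ i) * f (X \<omega> $ j) \<partial>M) \<and>
      (\<forall>k. odd k \<longrightarrow> summable (\<lambda>u. (deriv ^^ (2 * u + k)) f 0 / fact u * (S $ i $ i * (1 / 2)) ^ u)) \<and>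
      (\<lambda>m. G f S (2 * m + 1) i j (1 / 2) * (S $ i $ j) ^ (2 * m + 1) / fact (2 * m + 1))
        sums (\<integral>\<omega>. f (X \<omega> $ i) * f (X \<omega> $ j) \<partial>M)"
proof -
  note M = assms(1) and cov = assms(2) and inv = assms(3) and X = assms(4) and Y = assms(6)
  interpret prob_space M by (rule M)
  define a where "a p = (deriv ^^ p) f 0 / fact p" for p
  have a_even: "a p = 0" if "even p" for p
    using odd_series_taylor_coeffs(1)[OF assms(5) that] by (simp add: a_def)
  have f_sums: "(\<lambda>p. a p * x ^ p) sums f x" for x
    using odd_series_taylor_coeffs(2)[OF assms(5)] by (simp add: a_def)
  have f_odd: "f (- x) = - f x" for x
  proof -
    have "(\<lambda>p. - (a p * x ^ p)) sums f (- x)"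
    proof -
      have "a p * (- x) ^ p = - (a p * x ^ p)" for p
        using a_even[of p] by (cases "even p") auto
      then show ?thesis using f_sums[of "- x"] by simp
    qed
    then show ?thesis using sums_minus[OF f_sums[of x]] by (rule sums_unique2)
  qed
  define s where "s i = sqrt (S $ i $ i)" for i
  have s: "0 < s i" "(s i)\<^sup>2 = S $ i $ i" for i
    using invertible_covariance_entries(1)[OF cov inv, of i] by (auto simp: s_def)
  define Z where "Z i \<omega> = X \<omega> $ i / s i" for i \<omega>
  have X_eq: "X \<omega> $ i = s i * Z i \<omega>" for i \<omega> using s(1)[of i] by (simp add: Z_def)
  have pair: "gauss_pair M (Z i) (Z j) (S $ i $ j / (s i * s j))" for i j
    unfolding Z_def s_def by (rule mvn_gauss_pair[OF M cov inv X])
  define b where "b i p = a p * s i ^ p" for i p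
  have b_sums: "(\<lambda>p. b i p * x ^ p) sums f (s i * x)" for i x
    using f_sums[of "s i * x"] by (simp add: b_def power_mult_distrib mult.assoc)
  define c where "c i n = (\<Sum>p\<le>n. b i p * b i (n - p))" for i n
  have c_odd: "c i n = 0" if "odd n" for i n
    unfolding c_def
  proof (rule sum.neutral, rule ballI)
    fix p assume "p \<in> {..n}"
    with that have "even p \<or> even (n - p)" by auto
    then show "b i p * b i (n - p) = 0" by (auto simp: b_def a_even)
  qed
  \<comment> \<open>The diagonal instance of the convergence assumption: for $i = j$ the moment depends only on $n$, and the sum over
  $p$ collects to the coefficient of $x^n$ in the square of the series.\<close>
  have c_summable: "summable (\<lambda>n. c i n * normal_moment n)" for i
  proof -
    interpret gauss_pair M "Z i" "Z i" "S $ i $ i / (s i * s i)" by (rule pair)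
    have "(\<Sum>p=0..n. (deriv ^^ p) f 0 * (deriv ^^ (n - p)) f 0 / (fact p * fact (n - p)) * (\<integral>\<omega>. (X \<omega> $ i) ^ p * (X \<omega> $ i) ^ (n - p) \<partial>M))
        = c i n * normal_moment n" for n
      unfolding c_def sum_distrib_right
    proof (rule sum.cong)
      fix p assume "p \<in> {..n}"
      then have pow: "y ^ p * y ^ (n - p) = y ^ n" for y :: real by (simp flip: power_add)
      have "(\<integral>\<omega>. (X \<omega> $ i) ^ p * (X \<omega> $ i) ^ (n - p) \<partial>M) = s i ^ n * normal_moment n"
        unfolding pow unfolding X_eq power_mult_distrib using moment_Z(2)[of n] by simp
      then show "(deriv ^^ p) f 0 * (deriv ^^ (n - p)) f 0 / (fact p * fact (n - p)) * (\<integral>\<omega>. (X \<omega> $ i) ^ p * (X \<omega> $ i) ^ (n - p) \<partial>M)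
          = b i p * b i (n - p) * normal_moment n"
        using pow[of "s i"] by (simp add: b_def a_def)
    qed auto
    then show ?thesis using assms(7)[of i i] by simp
  qed
  have b_sub: "subgaussian_series (b i)" for i
  proof -
    have "Bseq (\<lambda>n. c i n * normal_moment n)"
      using summable_LIMSEQ_zero[OF c_summable] by (intro convergent_imp_Bseq convergentI)
    then obtain K where "\<And>n. \<bar>c i n * normal_moment n\<bar> \<le> K" unfolding Bseq_def by auto
    then show ?thesis
      by (rule subgaussian_if_square_moments_bounded[OF sums_summable[OF b_sums] c_def _ c_odd])
  qed
  have series_f: "series_fun (b i) x = f (s i * x)" for i x
    using series_fun_sums[OF b_sub] b_sums by (rule sums_unique2)
  have f_square: "integrable gauss (\<lambda>x. (series_fun (b i) x)\<^sup>2)" for i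
    by (rule integrable_square_if_moment_series_converges[OF b_sub c_def c_summable])
  have F_sums: "(\<lambda>u. (deriv ^^ (2 * u + k)) f 0 / fact u * (S $ i $ i * (1 / 2)) ^ u)
      sums (hermite_coeff (b i) k / s i ^ k)" for i k
    using hermite_coeff_scaled_taylor[of f "s i" k] b_sub[of i] s[of i]
    by (simp add: b_def[abs_def] a_def)
  have hermite_F: "hermite_coeff (b i) k = s i ^ k * F f k (S $ i $ i * (1 / 2))" for i k
  proof -
    have "F f k (S $ i $ i * (1 / 2)) = hermite_coeff (b i) k / s i ^ k"
      unfolding F_def by (rule sums_unique[OF F_sums, symmetric])
    then show ?thesis using s(1)[of i] by simp
  qed
  have hermite_even: "hermite_coeff (b i) k = 0" if "even k" for i k
  proof -
    have *: "b i p * hermite_moment p k = 0" for p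
    proof (cases "even p \<or> p < k")
      case True
      then show ?thesis by (auto simp: b_def a_even hermite_moment_eq_0)
    next
      case False
      with that have "odd (p - k)" by simp
      then show ?thesis by (simp add: hermite_moment_def normal_moment_odd)
    qed
    show ?thesis by (simp only: hermite_coeff_def * suminf_zero)
  qed
  \<comment> \<open>Off the diagonal the correlation lies strictly between $-1$ and $1$; on the diagonal it is $1$.\<close>
  have integrable_and_sums: "integrable M (\<lambda>\<omega>. f (X \<omega> $ i) * f (X \<omega> $ j)) \<and>
      (\<lambda>k. hermite_coeff (b i) k * hermite_coeff (b j) k * (S $ i $ j / (s i * s j)) ^ k / fact k)
        sums (\<integral>\<omega>. f (X \<omega> $ i) * f (X \<omega> $ j) \<partial>M)" for i j
  proof (cases "i = j")
    case False
    interpret gauss_pair M "Z i" "Z j" "S $ i $ j / (s i * s j)" by (rule pair)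
    have "(S $ i $ j / (s i * s j))\<^sup>2 < 1"
      using invertible_covariance_entries(2)[OF cov inv False] s[of i] s[of j]
        mult_pos_pos[OF invertible_covariance_entries(1,1)[OF cov inv], of i j]
      by (simp add: power_divide power_mult_distrib divide_less_eq)
    then have "\<bar>S $ i $ j / (s i * s j)\<bar> < 1" by (simp add: abs_square_less_1)
    then show ?thesis
      using integrable_series_product[OF b_sub[of i] b_sub[of j]] mehler_expansion[OF b_sub[of i] b_sub[of j]]
      by (simp add: series_f X_eq)
  next
    case True
    interpret gauss_pair M "Z i" "Z i" "S $ i $ i / (s i * s i)" by (rule pair)
    note [measurable] = series_fun_measurable[OF b_sub[of i]]
    have "integrable (distr M borel (Z i)) (\<lambda>x. (series_fun (b i) x)\<^sup>2)"
      unfolding distr_Z by (rule f_square)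
    then have int: "integrable M (\<lambda>\<omega>. (series_fun (b i) (Z i \<omega>))\<^sup>2)"
      by (subst (asm) integrable_distr_eq) auto
    have "(\<integral>x. (series_fun (b i) x)\<^sup>2 \<partial>gauss) = (\<integral>\<omega>. (series_fun (b i) (Z i \<omega>))\<^sup>2 \<partial>M)"
      unfolding distr_Z[symmetric] by (rule integral_distr) auto
    moreover have "S $ i $ i / (s i * s i) = 1"
      using s[of i] invertible_covariance_entries(1)[OF cov inv, of i] by (simp add: power2_eq_square)
    ultimately show ?thesis
      using int hermite_parseval[OF b_sub f_square, of i] True
        invertible_covariance_entries(1)[OF cov inv, of i]
      by (simp add: series_f X_eq power2_eq_square)
  qed
  have mean_0: "(\<integral>\<omega>. f (X \<omega> $ i) \<partial>M) = 0" for i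
  proof -
    have "(\<integral>\<omega>. series_fun (b i) (Z i \<omega>) \<partial>M) = 0"
      by (rule gauss_pair.expectation_odd_eq_0[OF pair[of i i] series_fun_measurable[OF b_sub]])
        (simp add: series_f f_odd)
    then show ?thesis by (simp add: series_f X_eq)
  qed
  have G_sums: "(\<lambda>m. G f S (2 * m + 1) i j (1 / 2) * (S $ i $ j) ^ (2 * m + 1) / fact (2 * m + 1))
        sums (\<integral>\<omega>. f (X \<omega> $ i) * f (X \<omega> $ j) \<partial>M)" for i j
  proof -
    let ?h = "\<lambda>k. hermite_coeff (b i) k * hermite_coeff (b j) k * (S $ i $ j / (s i * s j)) ^ k / fact k"
    have "?h sums (\<integral>\<omega>. f (X \<omega> $ i) * f (X \<omega> $ j) \<partial>M)" using integrable_and_sums by blast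
    moreover have "k \<notin> range (\<lambda>m. 2 * m + 1) \<Longrightarrow> ?h k = 0" for k
      using hermite_even[of k i] by (cases "even k") (auto elim!: oddE)
    ultimately have "(\<lambda>m. ?h (2 * m + 1)) sums (\<integral>\<omega>. f (X \<omega> $ i) * f (X \<omega> $ j) \<partial>M)"
      by (subst sums_mono_reindex[of "\<lambda>m. 2 * m + 1" ?h]) (auto simp: strict_mono_def)
    moreover have "?h k = G f S k i j (1 / 2) * (S $ i $ j) ^ k / fact k" for k
      using s(1)[of i] s(1)[of j] by (simp add: hermite_F G_def power_divide power_mult_distrib)
    ultimately show ?thesis by (simp only:)
  qed
  show ?thesis
  proof (intro allI conjI impI)
    fix i j
    show "integrable M (\<lambda>\<omega>. f (X \<omega> $ i) * f (X \<omega> $ j))" using integrable_and_sums by blast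
    show "covariance_matrix_of M Y $ i $ j = (\<integral>\<omega>. f (X \<omega> $ i) * f (X \<omega> $ j) \<partial>M)"
      by (simp add: covariance_matrix_of_def Y mean_0)
    show "summable (\<lambda>u. (deriv ^^ (2 * u + k)) f 0 / fact u * (S $ i $ i * (1 / 2)) ^ u)" for k
      by (rule sums_summable[OF F_sums])
    show "(\<lambda>m. G f S (2 * m + 1) i j (1 / 2) * (S $ i $ j) ^ (2 * m + 1) / fact (2 * m + 1))
        sums (\<integral>\<omega>. f (X \<omega> $ i) * f (X \<omega> $ j) \<partial>M)" by (rule G_sums)
  qed
qed

end
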